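(* Let $\mathcal N$ be the space of totally geodesic Lagrangian subspaces of $\mathbb H^{2m}_\tau$ to which the pseudo-Riemannian metric $g$ of $\mathbb H^{2m}_\tau$ restricts as a negative definite metric. As a homogeneous space, $\mathcal N$ is diffeomorphic to $\mathbb X_m=\mathrm{SL}(2m+1,\mathbb R)/\mathrm{SO}(2m+1)$.
   Context: $\mathbb R_\tau=\{x+\tau y:x,y\in\mathbb R\}$, $\tau^2=1$, $\overline{x+\tau y}^\tau=x-\tau y$, $e_\pm=(1\pm\tau)/2$, $\mathcal U=\{z\in\mathbb R_\tau:z\bar z^\tau=1\}$. On $\mathbb R_\tau^{2m+1}$, $\mathbf q(z,w)=z^tQ\bar w^\tau$ with $Q$ the antidiagonal matrix of $1$'s. $\mathbb H^{2m}_\tau=\{z:\mathbf q(z,z)=-1\}/\mathcal U$; $T_z\mathbb H^{2m}_\tau$ is identified with the $\mathbf q$-orthogonal complement of $z$; $\mathbf P$ is multiplication by $\tau$, $g$ the restriction of $\mathrm{Re}(\mathbf q)$ (signature $(2m,2m)$), $\omega=g(\cdot,\mathbf P\cdot)$ the symplectic form. $A\in\mathrm{SL}(2m+1,\mathbb R)$ acts on $\mathbb H^{2m}_\tau$ by isometries through the matrix $Ae_++Q(A^{-1})^tQe_-$. The elements of $\mathcal N$ are obtained by intersecting Lagrangian, negative definite real $(2m+1)$-planes of $\mathbb R_\tau^{2m+1}$ (with respect to $\mathrm{Re}(\mathbf q)$, $\mathrm{Im}(\mathbf q)$) with $\{\mathbf q(z,z)=-1\}$ and taking the quotient by $\mathcal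 U$. *)

theory Defs
  imports "HOL-Analysis.Analysis"
begin

section \<open>The algebra of paracomplex numbers\<close>

text \<open>\<open>Paracomplex x y\<close> is the number \<open>x + \<tau> y\<close>.\<close>

datatype paracomplex = Paracomplex (pRe: real) (pIm: real)

lemma paracomplex_eq_iff: "z = w \<longleftrightarrow> pRe z = pRe w \<and> pIm z = pIm w"
  by (cases z; cases w) simp

instantiation paracomplex :: comm_ring_1
begin

definition "0 = Paracomplex 0 0"
definition "1 = Paracomplex 1 0"
definition "z + w = Paracomplex (pRe z + pRe w) (pIm z + pIm w)"
definition "z - w = Paracomplex (pRe z - pRe w) (pIm z - pIm w)"
definition "- z = Paracomplex (- pRe z) (- pIm z)"
definition "z * w = Paracomplex (pRe z * pRe w + pIm z * pIm w) (pRe z * pIm w + pIm z * pRe w)"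

instance
  by standard
    (simp_all add: paracomplex_eq_iff zero_paracomplex_def one_paracomplex_def plus_paracomplex_def
      minus_paracomplex_def uminus_paracomplex_def times_paracomplex_def algebra_simps)

end

lemma paracomplex_simps [simp]:
  "pRe 0 = 0" "pIm 0 = 0" "pRe 1 = 1" "pIm 1 = 0"
  "pRe (z + w) = pRe z + pRe w" "pIm (z + w) = pIm z + pIm w"
  "pRe (z - w) = pRe z - pRe w" "pIm (z - w) = pIm z - pIm w"
  "pRe (- z) = - pRe z" "pIm (- z) = - pIm z"
  "pRe (z * w) = pRe z * pRe w + pIm z * pIm w" "pIm (z * w) = pRe z * pIm w + pIm z * pRe w"
  by (simp_all add: zero_paracomplex_def one_paracomplex_def plus_paracomplex_def
      minus_paracomplex_def uminus_paracomplex_def times_paracomplex_def)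

instantiation paracomplex :: real_algebra_1
begin

definition "scaleR r z = Paracomplex (r * pRe z) (r * pIm z)"

instance
  by standard (simp_all add: paracomplex_eq_iff scaleR_paracomplex_def algebra_simps)

end

lemma paracomplex_scaleR [simp]: "pRe (r *\<^sub>R z) = r * pRe z" "pIm (r *\<^sub>R z) = r * pIm z"
  by (simp_all add: scaleR_paracomplex_def)

text \<open>
  The Euclidean inner product below only serves to provide the usual topology of the real vector
  space of paracomplex numbers; it has nothing to do with the Hermitian form \<open>qform\<close>.
\<close>

instantiation paracomplex :: real_inner
begin

definition "inner z w = pRe z * pRe w + pIm z * pIm w"
definition "norm (z :: paracomplex) = sqrt (inner z z)"
definition "sgn (z :: paracomplex) = inverse (norm z) *\<^sub>R z"
definition "dist (z :: paracomplex) w = norm (z - w)"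
definition [code del]:
  "(uniformity :: (paracomplex \<times> paracomplex) filter)
     = (INF e\<in>{0 <..}. principal {(x, y). dist x y < e})"
definition [code del]:
  "open (U :: paracomplex set) \<longleftrightarrow> (\<forall>x\<in>U. eventually (\<lambda>(x', y). x' = x \<longrightarrow> y \<in> U) uniformity)"

instance
proof
  fix x y z :: paracomplex and r :: real
  show "inner x y = inner y x" "inner (x + y) z = inner x z + inner y z"
    "inner (r *\<^sub>R x) y = r * inner x y" "0 \<le> inner x x"
    by (simp_all add: inner_paracomplex_def algebra_simps)
  show "inner x x = 0 \<longleftrightarrow> x = 0"
    by (simp add: inner_paracomplex_def paracomplex_eq_iff sum_squares_eq_zero_iff)
qed (rule norm_paracomplex_def sgn_paracomplex_def dist_paracomplex_def
    uniformity_paracomplex_def open_paracomplex_def)+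

end

definition tau :: paracomplex where "tau = Paracomplex 0 1"

instantiation paracomplex :: euclidean_space
begin

definition "Basis = {1, tau}"

instance
proof
  fix u v x :: paracomplex
  have neq: "(1 :: paracomplex) \<noteq> tau"
    by (simp add: paracomplex_eq_iff tau_def)
  have inner_1: "inner x 1 = pRe x" and inner_tau: "inner x tau = pIm x"
    by (simp_all add: inner_paracomplex_def tau_def)
  show "(Basis :: paracomplex set) \<noteq> {}" "finite (Basis :: paracomplex set)"
    by (simp_all add: Basis_paracomplex_def)
  show "u \<in> Basis \<Longrightarrow> v \<in> Basis \<Longrightarrow> inner u v = (if u = v then 1 else 0)"
    using neq by (auto simp: Basis_paracomplex_def inner_paracomplex_def tau_def)
  show "(\<forall>u\<in>Basis. inner x u = 0) \<longleftrightarrow> x = 0"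
    by (simp add: Basis_paracomplex_def inner_1 inner_tau paracomplex_eq_iff [of x 0])
qed

end

definition pcnj :: "paracomplex \<Rightarrow> paracomplex"
  where "pcnj z = Paracomplex (pRe z) (- pIm z)"

definition e_plus :: paracomplex where "e_plus = Paracomplex (1/2) (1/2)"
definition e_minus :: paracomplex where "e_minus = Paracomplex (1/2) (- (1/2))"

definition unit_group :: "paracomplex set"
  where "unit_group = {u. u * pcnj u = 1}"


section \<open>Smooth maps and submanifolds of Euclidean spaces\<close>

primrec Ck_on :: "nat \<Rightarrow> 'a::real_normed_vector set \<Rightarrow> ('a \<Rightarrow> 'b::real_normed_vector) \<Rightarrow> bool" where
  "Ck_on 0 U f \<longleftrightarrow> continuous_on U f"
| "Ck_on (Suc k) U f \<longleftrightarrow>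
     f differentiable_on U \<and> (\<forall>v. Ck_on k U (\<lambda>x. frechet_derivative f (at x) v))"

text \<open>This is meant for open sets \<open>U\<close> of finite-dimensional spaces.\<close>

definition smooth_on_open :: "'a::real_normed_vector set \<Rightarrow> ('a \<Rightarrow> 'b::real_normed_vector) \<Rightarrow> bool"
  where "smooth_on_open U f \<longleftrightarrow> open U \<and> (\<forall>k. Ck_on k U f)"

text \<open>Smoothness on an arbitrary subset: the map extends locally to a smooth map on an open set.\<close>

definition smooth_on_subset :: "'a::real_normed_vector set \<Rightarrow> ('a \<Rightarrow> 'b::real_normed_vector) \<Rightarrow> bool"
  where "smooth_on_subset X f \<longleftrightarrow>
    (\<forall>x\<in>X. \<exists>U f'. x \<in> U \<and> smooth_on_open U f' \<and> (\<forall>y\<in>X \<inter> U. f' y = f y))"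

text \<open>Embedded \<open>k\<close>-dimensional submanifolds, by slice charts.\<close>

definition submanifold :: "nat \<Rightarrow> 'a::euclidean_space set \<Rightarrow> bool"
  where "submanifold k M \<longleftrightarrow>
    (\<forall>x\<in>M. \<exists>U V \<phi> \<psi> (E :: 'a set).
       x \<in> U \<and> smooth_on_open U \<phi> \<and> smooth_on_open V \<psi> \<and> homeomorphism U V \<phi> \<psi> \<and>
       subspace E \<and> dim E = k \<and> \<phi> ` (M \<inter> U) = E \<inter> V)"

text \<open>
  The curves are only required to be differentiable at \<open>0\<close>; for a submanifold this gives the usual
  tangent space.
\<close>

definition velocities :: "'a::real_normed_vector set \<Rightarrow> 'a \<Rightarrow> 'a set"
  where "velocities M x =
    {v. \<exists>\<gamma>. (\<forall>t::real. \<gamma> t \<in> M) \<and> \<gamma> 0 = x \<and> (\<gamma> has_vector_derivative v) (at 0)}"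

text \<open>
  Quotients of submanifolds \<open>X\<close>, \<open>Y\<close> of Euclidean spaces by surjective maps \<open>p\<close>, \<open>q\<close> carry the
  quotient smooth structure (for which \<open>p\<close>, \<open>q\<close> are submersions in the cases below). A map between
  such quotients is smooth if and only if it locally lifts to smooth maps \<open>X \<rightarrow> Y\<close>.
\<close>

definition quotient_smooth ::
  "'a::real_normed_vector set \<Rightarrow> ('a \<Rightarrow> 'p) \<Rightarrow> 'b::real_normed_vector set \<Rightarrow> ('b \<Rightarrow> 'q) \<Rightarrow> ('p \<Rightarrow> 'q) \<Rightarrow> bool"
  where "quotient_smooth X p Y q F \<longleftrightarrow>
    (\<forall>x\<in>X. \<exists>U h. open U \<and> x \<in> U \<and> smooth_on_subset (X \<inter> U) h \<and>
       (\<forall>x'\<in>X \<inter> U. h x' \<in> Y \<and> q (h x') = F (p x')))"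

definition quotient_diffeomorphism ::
  "'a::real_normed_vector set \<Rightarrow> ('a \<Rightarrow> 'p) \<Rightarrow> 'p set \<Rightarrow> 'b::real_normed_vector set \<Rightarrow> ('b \<Rightarrow> 'q) \<Rightarrow> 'q set
    \<Rightarrow> ('p \<Rightarrow> 'q) \<Rightarrow> bool"
  where "quotient_diffeomorphism X p P Y q Q F \<longleftrightarrow>
    p ` X = P \<and> q ` Y = Q \<and> bij_betw F P Q \<and>
    quotient_smooth X p Y q F \<and> quotient_smooth Y q X p (inv_into P F)"


section \<open>The paracomplex hyperbolic space\<close>

text \<open>
  The size of the matrices is the cardinality of the linearly ordered index type \<open>'n\<close>; the order is
  only used to say which entries of \<open>Q\<close> lie on the antidiagonal.
\<close>

type_synonym 'n pvec = "(paracomplex, 'n) vec"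
type_synonym 'n pmat = "('n pvec, 'n) vec"
type_synonym 'n rmat = "((real, 'n) vec, 'n) vec"

definition antidiag :: "'n::{finite,linorder} rmat"
  where "antidiag = (\<chi> i j. if card {k. k < i} = card {k. j < k} then 1 else 0)"

definition qform :: "'n::{finite,linorder} pvec \<Rightarrow> 'n pvec \<Rightarrow> paracomplex"
  where "qform z w = (\<Sum>i\<in>UNIV. \<Sum>j\<in>UNIV. z $ i * of_real (antidiag $ i $ j) * pcnj (w $ j))"

definition quadric :: "'n::{finite,linorder} pvec set"
  where "quadric = {z. qform z z = -1}"

text \<open>Points of the hyperbolic space are the orbits of the unit group on the quadric.\<close>

definition orbit :: "'n::finite pvec \<Rightarrow> 'n pvec set"
  where "orbit z = {u *s z |u. u \<in> unit_group}"

definition hyp :: "'n::{finite,linorder} pvec set set"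
  where "hyp = orbit ` quadric"

definition hyp_topology :: "'n::{finite,linorder} pvec set topology"
  where "hyp_topology = topology (\<lambda>W. W \<subseteq> hyp \<and> openin (top_of_set quadric) (\<Union>W))"

text \<open>
  \<open>tangent z\<close> is the tangent space of the hyperbolic space at \<open>orbit z\<close>; replacing \<open>z\<close> by \<open>u *s z\<close> with
  \<open>u\<close> in the unit group replaces \<open>w \<in> tangent z\<close> by \<open>u *s w\<close>.
\<close>

definition tangent :: "'n::{finite,linorder} pvec \<Rightarrow> 'n pvec set"
  where "tangent z = {w. qform w z = 0}"

definition metric_g :: "'n::{finite,linorder} pvec \<Rightarrow> 'n pvec \<Rightarrow> real"
  where "metric_g v w = pRe (qform v w)"

definition omega :: "'n::{finite,linorder} pvec \<Rightarrow> 'n pvec \<Rightarrow> real"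
  where "omega v w = metric_g v (tau *s w)"


section \<open>Totally geodesic Lagrangian subspaces\<close>

text \<open>
  The quadric is a submersion onto the hyperbolic space with one-dimensional fibres, so \<open>S\<close> is a
  \<open>k\<close>-dimensional submanifold if and only if its preimage \<open>\<Union>S\<close> in the quadric is a
  \<open>(k + 1)\<close>-dimensional one. The tangent space of \<open>S\<close> at \<open>orbit z\<close> is the horizontal part of the
  tangent space of \<open>\<Union>S\<close> at \<open>z\<close>.
\<close>

definition hyp_submanifold :: "nat \<Rightarrow> 'n::{finite,linorder} pvec set set \<Rightarrow> bool"
  where "hyp_submanifold k S \<longleftrightarrow> S \<subseteq> hyp \<and> submanifold (k + 1) (\<Union>S)"

definition tangent_sub ::
  "'n::{finite,linorder} pvec set set \<Rightarrow> 'n pvec \<Rightarrow> 'n pvec set"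
  where "tangent_sub S z = velocities (\<Union>S) z \<inter> tangent z"

text \<open>
  The Levi-Civita derivative of a vector field \<open>v\<close> along a horizontal curve \<open>\<gamma>\<close> in the quadric is the
  projection \<open>v' + qform v' \<gamma> *s \<gamma>\<close> of its flat derivative \<open>v'\<close> to \<open>tangent \<gamma>\<close>. Geodesics of the
  hyperbolic space are represented by their horizontal lifts. All of them are defined for all times.
\<close>

definition geodesic :: "(real \<Rightarrow> 'n::{finite,linorder} pvec) \<Rightarrow> bool"
  where "geodesic \<gamma> \<longleftrightarrow> (\<exists>\<gamma>' \<gamma>''. \<forall>t.
    \<gamma> t \<in> quadric \<and>
    (\<gamma> has_vector_derivative \<gamma>' t) (at t) \<and> (\<gamma>' has_vector_derivative \<gamma>'' t) (at t) \<and>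
    \<gamma>' t \<in> tangent (\<gamma> t) \<and>
    \<gamma>'' t + qform (\<gamma>'' t) (\<gamma> t) *s \<gamma> t = 0)"

text \<open>
  Totally geodesic subspaces are understood to be complete: the geodesics of the ambient space which
  are tangent to \<open>S\<close> stay in \<open>S\<close> for all times.
\<close>

definition totally_geodesic :: "'n::{finite,linorder} pvec set set \<Rightarrow> bool"
  where "totally_geodesic S \<longleftrightarrow>
    (\<forall>\<gamma>. geodesic \<gamma> \<and> \<gamma> 0 \<in> \<Union>S \<and> vector_derivative \<gamma> (at 0) \<in> tangent_sub S (\<gamma> 0)
       \<longrightarrow> (\<forall>t. \<gamma> t \<in> \<Union>S))"

text \<open>The dimension \<open>CARD('n) - 1\<close> is half of the real dimension of the hyperbolic space.\<close>

definition lagrangian :: "'n::{finite,linorder} pvec set set \<Rightarrow> bool"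
  where "lagrangian S \<longleftrightarrow> hyp_submanifold (CARD('n) - 1) S \<and>
    (\<forall>z\<in>\<Union>S. \<forall>v\<in>tangent_sub S z. \<forall>w\<in>tangent_sub S z. omega v w = 0)"

definition neg_definite :: "'n::{finite,linorder} pvec set set \<Rightarrow> bool"
  where "neg_definite S \<longleftrightarrow> (\<forall>z\<in>\<Union>S. \<forall>v\<in>tangent_sub S z. v \<noteq> 0 \<longrightarrow> metric_g v v < 0)"

definition space_N :: "'n::{finite,linorder} pvec set set set"
  where "space_N = {S. S \<noteq> {} \<and> connectedin hyp_topology S \<and>
    lagrangian S \<and> totally_geodesic S \<and> neg_definite S}"

text \<open>
  The smooth structure of \<open>space_N\<close>: its elements are the traces of the Lagrangian, negative definite
  planes, and these planes form an open subset of the Lagrangian Grassmannian, presented as usual as a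
  quotient of the manifold of frames. A frame is a matrix whose rows are a basis of the plane. Planes
  differing by an element of the unit group have the same trace. It agrees with the smooth structure of
  \<open>space_N\<close> as a homogeneous space if the diffeomorphism from the coset space is equivariant.
\<close>

definition lagrangian_neg_planes :: "'n::{finite,linorder} pvec set set"
  where "lagrangian_neg_planes = {V. subspace V \<and> dim V = CARD('n) \<and>
    (\<forall>v\<in>V. \<forall>w\<in>V. pIm (qform v w) = 0) \<and> (\<forall>v\<in>V. v \<noteq> 0 \<longrightarrow> pRe (qform v v) < 0)}"

definition frames :: "'n::{finite,linorder} pmat set"
  where "frames = {Z. span (rows Z) \<in> lagrangian_neg_planes}"

definition plane_trace :: "'n::{finite,linorder} pvec set \<Rightarrow> 'n pvec set set"
  where "plane_trace V = orbit ` (V \<inter> quadric)"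


section \<open>The special linear group\<close>

definition SL :: "'n::finite rmat set"
  where "SL = {A. det A = 1}"

definition SO :: "'n::finite rmat set"
  where "SO = {R. orthogonal_matrix R \<and> det R = 1}"

definition SO_coset :: "'n::finite rmat \<Rightarrow> 'n rmat set"
  where "SO_coset A = (\<lambda>R. A ** R) ` SO"

definition space_X :: "'n::finite rmat set set"
  where "space_X = SO_coset ` SL"

definition act_X :: "'n::finite rmat \<Rightarrow> 'n rmat set \<Rightarrow> 'n rmat set"
  where "act_X A c = (\<lambda>B. A ** B) ` c"

definition act_matrix :: "'n::{finite,linorder} rmat \<Rightarrow> 'n pmat"
  where "act_matrix A = (\<chi> i j. of_real (A $ i $ j) * e_plus
    + of_real ((antidiag ** transpose (matrix_inv A) ** antidiag) $ i $ j) * e_minus)"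

definition act_hyp ::
  "'n::{finite,linorder} rmat \<Rightarrow> 'n pvec set \<Rightarrow> 'n pvec set"
  where "act_hyp A p = (\<lambda>z. act_matrix A *v z) ` p"

definition act_N ::
  "'n::{finite,linorder} rmat \<Rightarrow> 'n pvec set set \<Rightarrow> 'n pvec set set"
  where "act_N A S = act_hyp A ` S"

end

theory Submission
  imports Defs
begin

text \<open>
  Write \<open>z = x e\<^sub>+ + (Q y) e\<^sub>-\<close> with real vectors \<open>x\<close> (\<open>vec_part\<close>) and \<open>y\<close> (\<open>covec_part\<close>). Conjugation
  exchanges the idempotents, so the Hermitian form becomes
  \<open>(x \<bullet> y') e\<^sub>+ + (y \<bullet> x') e\<^sub>-\<close>: the paracomplex space is the sum of a real vector space and its dual,
  the quadric is \<open>x \<bullet> y = -1\<close>, a unit acts by \<open>(a x, y / a)\<close> and a matrix \<open>A\<close> by \<open>(A x, A\<^sup>-\<^sup>t y)\<close>.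

  A Lagrangian negative definite plane meets \<open>x = 0\<close> trivially, hence is the graph of \<open>y = - P x\<close> with
  \<open>P\<close> symmetric and positive definite. Units replace \<open>P\<close> by a positive multiple, so the traces of such
  planes correspond to positive definite matrices of determinant \<open>1\<close>, that is, to the cosets
  \<open>A SO\<close> by \<open>P = A\<^sup>-\<^sup>t A\<^sup>-\<^sup>1\<close>. This correspondence is clearly equivariant. It is smooth since \<open>A\<close> yields
  the frame with the rows \<open>(A e\<^sub>i, - A\<^sup>-\<^sup>t e\<^sub>i)\<close>, and its inverse is smooth since the Gram-Schmidt
  process, followed by a normalisation of the determinant, turns a frame into a matrix
  (\<open>smooth_local_section\<close>). In odd dimension the sign of the determinant can be absorbed in the scalar.

  What remains is that the traces of these planes are exactly the elements of \<open>space_N\<close>. The preimage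
  of the trace of the graph of \<open>- P\<close> in the quadric is itself the graph of
  \<open>x \<mapsto> - P x / (x \<bullet> P x)\<close> over the nonzero vectors, which makes all its properties explicit; it is
  totally geodesic because geodesics solve a linear equation \<open>\<gamma>'' = k \<gamma>\<close> and so stay in the plane spanned
  by their initial data (\<open>trace_in_space_N\<close>).

  Conversely, let \<open>S\<close> be in \<open>space_N\<close> and \<open>z\<close> a point of its preimage. The plane spanned by \<open>z\<close> and the
  tangent space of \<open>S\<close> at \<open>z\<close> is Lagrangian and negative definite, and the geodesics through \<open>z\<close>, being
  the circles \<open>cos (\<kappa> t) z + sin (\<kappa> t) \<xi> / \<kappa>\<close>, fill its intersection with the quadric
  (\<open>ex_tangent_plane\<close>). So the trace of this plane lies in \<open>S\<close>. It is closed, and it is open in \<open>S\<close> by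
  invariance of domain, since both have the same dimension. As \<open>S\<close> is connected, they are equal
  (\<open>space_N_eq_trace\<close>).
\<close>

section \<open>Closure properties of smooth maps\<close>

lemma Ck_on_cong:
  assumes "open U" "\<And>x. x \<in> U \<Longrightarrow> f x = g x"
  shows "Ck_on k U f \<longleftrightarrow> Ck_on k U g"
  using assms(2)
proof (induction k arbitrary: f g)
  case 0
  then show ?case by (simp cong: continuous_on_cong)
next
  case (Suc k)
  have derivative_iff: "(f has_derivative D) (at x) \<longleftrightarrow> (g has_derivative D) (at x)" if "x \<in> U" for D x
    using has_derivative_transform_within_open[OF _ \<open>open U\<close> that] Suc.prems by metis
  have "frechet_derivative f (at x) v = frechet_derivative g (at x) v" if "x \<in> U" for x v
    unfolding frechet_derivative_def by (simp add: derivative_iff[OF that])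
  then have "Ck_on k U (\<lambda>x. frechet_derivative f (at x) v) \<longleftrightarrow> Ck_on k U (\<lambda>x. frechet_derivative g (at x) v)" for v
    by (intro Suc.IH)
  moreover have "f differentiable_on U \<longleftrightarrow> g differentiable_on U"
    using derivative_iff \<open>open U\<close>
    by (auto simp: differentiable_on_eq_differentiable_at differentiable_def)
  ultimately show ?case by simp
qed

text \<open>
  Every formula for the derivative can take the place of \<open>frechet_derivative\<close>, so that the closure
  properties below follow from the usual rules of differentiation by induction on the order.
\<close>

lemma Ck_on_SucI:
  assumes "open U" "\<And>x. x \<in> U \<Longrightarrow> (f has_derivative f' x) (at x)"
    and "\<And>v. Ck_on k U (\<lambda>x. f' x v)"
  shows "Ck_on (Suc k) U f"
proof -
  have "Ck_on k U (\<lambda>x. frechet_derivative f (at x) v)" for v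
    using Ck_on_cong[OF \<open>open U\<close>, of "\<lambda>x. frechet_derivative f (at x) v" "\<lambda>x. f' x v"]
      assms(2,3) frechet_derivative_at by metis
  moreover have "f differentiable_on U"
    using assms(1,2) by (auto simp: differentiable_on_eq_differentiable_at differentiable_def)
  ultimately show ?thesis by simp
qed

lemma Ck_on_SucD:
  assumes "open U" "Ck_on (Suc k) U f" "x \<in> U"
  shows "(f has_derivative frechet_derivative f (at x)) (at x)"
  using assms by (auto simp: differentiable_on_eq_differentiable_at frechet_derivative_works)

lemma Ck_on_lower: "Ck_on (Suc k) U f \<Longrightarrow> Ck_on k U f"
  by (induction k arbitrary: f) (auto intro: differentiable_imp_continuous_on)

lemma Ck_on_const: "open U \<Longrightarrow> Ck_on k U (\<lambda>x. c)"
  by (induction k arbitrary: c) (simp, rule Ck_on_SucI[OF _ has_derivative_const], auto)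

lemma Ck_on_linear:
  assumes "open U" "bounded_linear L"
  shows "Ck_on k U L"
proof (cases k)
  case 0
  then show ?thesis using assms by (simp add: linear_continuous_on)
next
  case (Suc j)
  show ?thesis unfolding Suc
    by (rule Ck_on_SucI[OF assms(1) bounded_linear_imp_has_derivative[OF assms(2)]])
      (rule Ck_on_const[OF assms(1)])
qed

lemma Ck_on_linear_comp:
  assumes "open U" "bounded_linear L" "Ck_on k U f"
  shows "Ck_on k U (\<lambda>x. L (f x))"
  using assms(3)
proof (induction k arbitrary: f)
  case 0
  then show ?case using assms(2)
    by (simp add: bounded_linear.continuous_on)
next
  case (Suc k)
  show ?case
    by (rule Ck_on_SucI[OF assms(1)
          bounded_linear.has_derivative[OF assms(2) Ck_on_SucD[OF assms(1) Suc.prems]]])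
      (use Suc in auto)
qed

lemma Ck_on_add:
  assumes "open U" "Ck_on k U f" "Ck_on k U g"
  shows "Ck_on k U (\<lambda>x. f x + g x)"
  using assms(2,3)
proof (induction k arbitrary: f g)
  case 0
  then show ?case by (simp add: continuous_on_add)
next
  case (Suc k)
  show ?case
    by (rule Ck_on_SucI[OF assms(1) has_derivative_add[OF Ck_on_SucD[OF assms(1) Suc.prems(1)]
          Ck_on_SucD[OF assms(1) Suc.prems(2)]]]) (use Suc in auto)
qed

lemma Ck_on_bilinear:
  assumes "bounded_bilinear h" "open U" "Ck_on k U f" "Ck_on k U g"
  shows "Ck_on k U (\<lambda>x. h (f x) (g x))"
  using assms(3,4)
proof (induction k arbitrary: f g)
  case 0
  then show ?case using assms(1) by (simp add: bounded_bilinear.continuous_on)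
next
  case (Suc k)
  note lower = Suc.prems[THEN Ck_on_lower]
  show ?case
    by (rule Ck_on_SucI[OF assms(2) bounded_bilinear.FDERIV[OF assms(1)
          Ck_on_SucD[OF assms(2) Suc.prems(1)] Ck_on_SucD[OF assms(2) Suc.prems(2)]]])
      (use Suc.prems in \<open>auto intro!: Ck_on_add Suc.IH lower assms(2)\<close>)
qed

text \<open>
  The induction needs all exponents at once, because the derivative contains \<open>g x powr (a - 1)\<close>.
  Real powers provide the reciprocals, the square roots in the Gram-Schmidt process and the root of the
  determinant.
\<close>

lemma Ck_on_powr:
  fixes g :: "'a::real_normed_vector \<Rightarrow> real"
  assumes "open U" "Ck_on k U g" "\<And>x. x \<in> U \<Longrightarrow> g x > 0"
  shows "Ck_on k U (\<lambda>x. g x powr a)"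
  using assms(2)
proof (induction k arbitrary: a)
  case 0
  then show ?case using assms(3) by (fastforce intro!: continuous_on_powr continuous_intros)
next
  case (Suc k)
  let ?D = "\<lambda>x v. frechet_derivative g (at x) v * (a * g x powr (a - 1))"
  have "((\<lambda>x. g x powr a) has_derivative ?D x) (at x)" if "x \<in> U" for x
  proof -
    have "((\<lambda>y. y powr a) has_real_derivative a * g x powr (a - 1)) (at (g x))"
      using assms(3)[OF that] by (rule has_real_derivative_powr)
    from DERIV_compose_FDERIV[OF this Ck_on_SucD[OF assms(1) Suc.prems that]] show ?thesis .
  qed
  moreover have "Ck_on k U (\<lambda>x. ?D x v)" for v
    using Suc by (intro Ck_on_bilinear[OF bounded_bilinear_mult] assms(1) Ck_on_const
        Suc.IH Ck_on_lower[OF Suc.prems]) auto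
  ultimately show ?case by (rule Ck_on_SucI[OF assms(1)])
qed

lemma smooth_on_open_const: "open U \<Longrightarrow> smooth_on_open U (\<lambda>x. c)"
  by (simp add: smooth_on_open_def Ck_on_const)

lemma smooth_on_open_linear: "open U \<Longrightarrow> bounded_linear L \<Longrightarrow> smooth_on_open U L"
  by (simp add: smooth_on_open_def Ck_on_linear)

lemma smooth_on_open_linear_comp:
  "bounded_linear L \<Longrightarrow> smooth_on_open U f \<Longrightarrow> smooth_on_open U (\<lambda>x. L (f x))"
  by (simp add: smooth_on_open_def Ck_on_linear_comp)

lemma smooth_on_open_add:
  "smooth_on_open U f \<Longrightarrow> smooth_on_open U g \<Longrightarrow> smooth_on_open U (\<lambda>x. f x + g x)"
  by (simp add: smooth_on_open_def Ck_on_add)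

lemma smooth_on_open_bilinear:
  "bounded_bilinear h \<Longrightarrow> smooth_on_open U f \<Longrightarrow> smooth_on_open U g
    \<Longrightarrow> smooth_on_open U (\<lambda>x. h (f x) (g x))"
  by (simp add: smooth_on_open_def Ck_on_bilinear)

lemmas smooth_on_open_mult = smooth_on_open_bilinear[OF bounded_bilinear_mult]
lemmas smooth_on_open_scaleR = smooth_on_open_bilinear[OF bounded_bilinear_scaleR]
lemmas smooth_on_open_inner = smooth_on_open_bilinear[OF bounded_bilinear_inner]

lemma smooth_on_open_diff:
  assumes "smooth_on_open U f" "smooth_on_open U g"
  shows "smooth_on_open U (\<lambda>x. f x - g x)"
  using smooth_on_open_add[OF assms(1)
      smooth_on_open_linear_comp[OF bounded_linear_minus[OF bounded_linear_ident] assms(2)]] by simp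

lemma smooth_on_open_sum:
  assumes "open U" "\<And>i. i \<in> I \<Longrightarrow> smooth_on_open U (f i)"
  shows "smooth_on_open U (\<lambda>x. \<Sum>i\<in>I. f i x)"
  using assms(2) by (induction I rule: infinite_finite_induct)
    (auto intro: smooth_on_open_add smooth_on_open_const assms(1))

lemma smooth_on_open_prod:
  fixes f :: "'i \<Rightarrow> 'a::real_normed_vector \<Rightarrow> real"
  assumes "open U" "\<And>i. i \<in> I \<Longrightarrow> smooth_on_open U (f i)"
  shows "smooth_on_open U (\<lambda>x. \<Prod>i\<in>I. f i x)"
  using assms(2) by (induction I rule: infinite_finite_induct)
    (auto intro: smooth_on_open_mult smooth_on_open_const assms(1))

lemma smooth_on_open_powr:
  fixes g :: "'a::real_normed_vector \<Rightarrow> real"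
  shows "smooth_on_open U g \<Longrightarrow> (\<And>x. x \<in> U \<Longrightarrow> g x > 0) \<Longrightarrow> smooth_on_open U (\<lambda>x. g x powr a)"
  by (simp add: smooth_on_open_def Ck_on_powr)

lemma smooth_on_open_inverse:
  fixes g :: "'a::real_normed_vector \<Rightarrow> real"
  assumes "smooth_on_open U g" "\<And>x. x \<in> U \<Longrightarrow> g x > 0"
  shows "smooth_on_open U (\<lambda>x. inverse (g x))"
proof -
  have U: "open U" using assms(1) by (simp add: smooth_on_open_def)
  have "Ck_on k U (\<lambda>x. inverse (g x))" for k
  proof -
    have "Ck_on k U (\<lambda>x. g x powr (-1))"
      using smooth_on_open_powr[OF assms, of "-1"] by (simp add: smooth_on_open_def)
    moreover have "inverse (g x) = g x powr (-1)" if "x \<in> U" for x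
      using assms(2)[OF that] by (simp add: powr_minus)
    ultimately show ?thesis
      using Ck_on_cong[OF U, of "\<lambda>x. inverse (g x)" "\<lambda>x. g x powr (-1)"] by simp
  qed
  with U show ?thesis by (simp add: smooth_on_open_def)
qed

lemma bounded_linear_axis: "bounded_linear (axis i :: 'b::real_normed_vector \<Rightarrow> 'b ^ 'n)"
proof
  show "axis i (x + y) = axis i x + (axis i y :: 'b ^ 'n)" for x y
    by (simp add: vec_eq_iff axis_def)
  show "axis i (r *\<^sub>R x) = r *\<^sub>R (axis i x :: 'b ^ 'n)" for r x
    by (simp add: vec_eq_iff axis_def)
  have "norm (axis i x :: 'b ^ 'n) \<le> norm x * 1" for x
  proof -
    have "norm (axis i x :: 'b ^ 'n) \<le> (\<Sum>j\<in>UNIV. norm (axis i x $ j :: 'b))"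
      unfolding norm_vec_def by (rule L2_set_le_sum) simp
    also have "\<dots> = (\<Sum>j\<in>UNIV. if j = i then norm x else 0)"
      by (rule sum.cong) (auto simp: axis_def)
    finally show ?thesis by simp
  qed
  then show "\<exists>K. \<forall>x. norm (axis i x :: 'b ^ 'n) \<le> norm x * K" by blast
qed

lemma smooth_on_open_vec_lambda:
  fixes f :: "'i::finite \<Rightarrow> 'a::real_normed_vector \<Rightarrow> 'b::real_normed_vector"
  assumes "open U" "\<And>i. smooth_on_open U (f i)"
  shows "smooth_on_open U (\<lambda>x. \<chi> i. f i x)"
proof -
  have "(\<lambda>x. \<chi> i. f i x) = (\<lambda>x. \<Sum>i\<in>UNIV. axis i (f i x))"
    by (simp add: fun_eq_iff vec_eq_iff axis_def)
  moreover have "smooth_on_open U (\<lambda>x. \<Sum>i\<in>UNIV. axis i (f i x) :: 'b ^ 'i)"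
    by (intro smooth_on_open_sum smooth_on_open_linear_comp[OF bounded_linear_axis] assms)
  ultimately show ?thesis by simp
qed

lemma smooth_on_open_nth:
  "smooth_on_open U f \<Longrightarrow> smooth_on_open U (\<lambda>x. f x $ i)"
  by (rule smooth_on_open_linear_comp[OF bounded_linear_vec_nth])

lemma smooth_on_open_det:
  fixes M :: "'a::real_normed_vector \<Rightarrow> 'n::finite rmat"
  assumes "open U" "smooth_on_open U M"
  shows "smooth_on_open U (\<lambda>x. det (M x))"
  unfolding det_def
  by (intro smooth_on_open_sum smooth_on_open_mult smooth_on_open_prod smooth_on_open_const
      smooth_on_open_nth assms)

lemma smooth_on_open_subset:
  assumes "smooth_on_open U f" "W \<subseteq> U" "open W"
  shows "smooth_on_open W f"
proof -
  have "Ck_on k W f" if "Ck_on k U f" for k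
    using that
  proof (induction k arbitrary: f)
    case 0
    then show ?case using assms(2) by (auto intro: continuous_on_subset)
  next
    case (Suc k)
    then show ?case using assms(2) by (auto intro: differentiable_on_subset)
  qed
  then show ?thesis using assms by (simp add: smooth_on_open_def)
qed

lemma smooth_on_open_imp_continuous_on: "smooth_on_open U f \<Longrightarrow> continuous_on U f"
  unfolding smooth_on_open_def using Ck_on.simps(1) by blast

lemma smooth_on_open_imp_has_derivative:
  assumes "smooth_on_open U f" "x \<in> U"
  shows "(f has_derivative frechet_derivative f (at x)) (at x)"
  using assms Ck_on_SucD unfolding smooth_on_open_def by blast

lemma smooth_on_open_imp_subset:
  "smooth_on_open U f \<Longrightarrow> X \<subseteq> U \<Longrightarrow> smooth_on_subset X f"
  unfolding smooth_on_subset_def by blast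

section \<open>Vector and covector parts\<close>

text \<open>
  The coefficient of \<open>e\<^sub>+\<close>.
\<close>

definition vec_part :: "'n::{finite,linorder} pvec \<Rightarrow> (real, 'n) vec"
  where "vec_part z = (\<chi> i. pRe (z $ i) + pIm (z $ i))"

text \<open>
  The coefficient of \<open>e\<^sub>-\<close>, multiplied by \<open>Q\<close>. This removes \<open>Q\<close> from the Hermitian form, which turns
  into the duality of vectors and covectors, and from the action of the special linear group, which turns
  into the standard action and its contragredient.
\<close>

definition covec_part :: "'n::{finite,linorder} pvec \<Rightarrow> (real, 'n) vec"
  where "covec_part z = antidiag *v (\<chi> i. pRe (z $ i) - pIm (z $ i))"

definition of_parts :: "(real, 'n) vec \<Rightarrow> (real, 'n) vec \<Rightarrow> 'n::{finite,linorder} pvec"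
  where "of_parts x y = (\<chi> i. Paracomplex ((x $ i + (antidiag *v y) $ i) / 2)
    ((x $ i - (antidiag *v y) $ i) / 2))"

definition pairing :: "'n::{finite,linorder} pvec \<Rightarrow> 'n pvec \<Rightarrow> real"
  where "pairing z w = vec_part z \<bullet> covec_part w"

lemma card_below_above:
  fixes i :: "'n::{finite,linorder}"
  shows "card {k. k < i} + 1 + card {k. i < k} = CARD('n)"
proof -
  have "UNIV = insert i ({k. k < i} \<union> {k. i < k})" by auto
  moreover have "card (insert i ({k. k < i} \<union> {k. i < k})) = Suc (card ({k. k < i} \<union> {k. i < k}))"
    by (rule card_insert_disjoint) auto
  moreover have "card ({k. k < i} \<union> {k. i < k}) = card {k. k < i} + card {k. i < k}"
    by (rule card_Un_disjoint) auto
  ultimately show ?thesis by simp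
qed

lemma bij_rank: "bij_betw (\<lambda>i. card {k. k < i}) (UNIV :: 'n::{finite,linorder} set) {..<CARD('n)}"
proof -
  have "strict_mono (\<lambda>i::'n. card {k. k < i})"
  proof (rule strict_monoI)
    fix i j :: 'n assume "i < j"
    then have "{k. k < i} \<subset> {k. k < j}" by auto
    then show "card {k. k < i} < card {k. k < j}" by (intro psubset_card_mono) auto
  qed
  then have inj: "inj (\<lambda>i::'n. card {k. k < i})" by (rule strict_mono_imp_inj_on)
  moreover have sub: "range (\<lambda>i::'n. card {k. k < i}) \<subseteq> {..<CARD('n)}"
  proof -
    have "card {k. k < i} < CARD('n)" for i :: 'n using card_below_above[of i] by linarith
    then show ?thesis by auto
  qed
  ultimately show ?thesis
    unfolding bij_betw_def using card_image[OF inj] by (simp add: card_subset_eq)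
qed

text \<open>
  In terms of the number of smaller indices the condition is symmetric in \<open>i\<close> and \<open>j\<close>, and as this number
  determines the index, every row has exactly one nonzero entry.
\<close>

lemma antidiag_nth:
  "(antidiag :: 'n::{finite,linorder} rmat) $ i $ j
    = (if card {k. k < i} + card {k. k < j} + 1 = CARD('n) then 1 else 0)"
  using card_below_above[of j] unfolding antidiag_def by auto

lemma transpose_antidiag: "transpose antidiag = antidiag"
  by (simp add: vec_eq_iff transpose_def antidiag_nth add.commute)

lemma antidiag_involution: "antidiag ** antidiag = (mat 1 :: 'n::{finite,linorder} rmat)"
proof -
  have "(\<Sum>k\<in>UNIV. antidiag $ i $ k * antidiag $ k $ j) = (if i = j then 1 else 0 :: real)"
    for i j :: 'n
  proof -
    have "CARD('n) - 1 - card {k. k < i} \<in> {..<CARD('n)}"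
      by (simp add: less_le_trans[OF diff_less])
    then obtain l :: 'n where l: "card {k. k < l} = CARD('n) - 1 - card {k. k < i}"
      using bij_rank[where 'n='n] by (metis (no_types, lifting) bij_betw_iff_bijections)
    have rank_inj: "card {k. k < a} = card {k. k < b} \<longleftrightarrow> a = b" for a b :: 'n
      using bij_rank[where 'n='n] by (auto simp: bij_betw_def inj_on_def)
    have l_iff: "card {k. k < i} + card {k. k < a} + 1 = CARD('n) \<longleftrightarrow> a = l" for a
      using l card_below_above[of i] rank_inj[of a l] by auto
    have j_iff: "card {k. k < l} + card {k. k < j} + 1 = CARD('n) \<longleftrightarrow> i = j"
      using l card_below_above[of i] rank_inj[of i j] by auto
    have "(\<Sum>k\<in>UNIV. antidiag $ i $ k * antidiag $ k $ j)
        = (\<Sum>k\<in>UNIV. if k = l then (if i = j then 1 else 0) else (0::real))"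
    proof (rule sum.cong)
      fix k :: 'n
      show "antidiag $ i $ k * antidiag $ k $ j = (if k = l then if i = j then 1 else 0 else (0::real))"
        using l_iff[of k] j_iff by (cases "k = l") (simp_all add: antidiag_nth)
    qed simp
    then show ?thesis by simp
  qed
  then show ?thesis by (simp add: vec_eq_iff matrix_matrix_mult_def mat_def)
qed

lemma antidiag_vec_involution [simp]:
  "antidiag *v (antidiag *v x) = (x :: (real, 'n::{finite,linorder}) vec)"
  by (simp add: matrix_vector_mul_assoc antidiag_involution)

lemma inner_antidiag: "(antidiag *v x) \<bullet> y = x \<bullet> (antidiag *v (y :: (real, 'n::{finite,linorder}) vec))"
  using dot_lmul_matrix[of x antidiag y] vector_transpose_matrix[of x antidiag]
  by (simp add: transpose_antidiag)

lemma vec_part_of_parts [simp]: "vec_part (of_parts x y) = x"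
  by (simp add: vec_part_def of_parts_def vec_eq_iff flip: add_divide_distrib)

lemma covec_part_of_parts [simp]: "covec_part (of_parts x y) = y"
proof -
  have "(\<chi> i. pRe (of_parts x y $ i) - pIm (of_parts x y $ i)) = antidiag *v y"
    by (simp add: of_parts_def vec_eq_iff flip: diff_divide_distrib)
  then show ?thesis by (simp add: covec_part_def)
qed

lemma parts_eqI: "vec_part z = vec_part w \<Longrightarrow> covec_part z = covec_part w \<Longrightarrow> z = w"
proof -
  assume vec: "vec_part z = vec_part w" and "covec_part z = covec_part w"
  then have "(\<chi> i. pRe (z $ i) - pIm (z $ i)) = (\<chi> i. pRe (w $ i) - pIm (w $ i))"
    unfolding covec_part_def by (metis antidiag_vec_involution)
  with vec have sums: "pRe (z $ i) + pIm (z $ i) = pRe (w $ i) + pIm (w $ i)"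
    "pRe (z $ i) - pIm (z $ i) = pRe (w $ i) - pIm (w $ i)" for i
    unfolding vec_part_def vec_eq_iff by auto
  have "pRe (z $ i) = pRe (w $ i) \<and> pIm (z $ i) = pIm (w $ i)" for i
    using sums[of i] by linarith
  then show "z = w" by (simp add: vec_eq_iff paracomplex_eq_iff)
qed

lemma of_parts_parts [simp]: "of_parts (vec_part z) (covec_part z) = z"
  by (rule parts_eqI) simp_all

lemma vec_part_unit_scale: "vec_part (u *s z) = (pRe u + pIm u) *\<^sub>R vec_part z"
  by (simp add: vec_part_def vec_eq_iff algebra_simps)

lemma covec_part_unit_scale: "covec_part (u *s z) = (pRe u - pIm u) *\<^sub>R covec_part z"
proof -
  have "(\<chi> i. pRe ((u *s z) $ i) - pIm ((u *s z) $ i))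
      = (pRe u - pIm u) *\<^sub>R (\<chi> i. pRe (z $ i) - pIm (z $ i))"
    by (simp add: vec_eq_iff algebra_simps)
  then show ?thesis
    by (simp add: covec_part_def matrix_vector_mult_scaleR)
qed

lemma linear_vec_part: "linear vec_part"
  by (rule linearI) (simp_all add: vec_part_def vec_eq_iff algebra_simps)

lemma linear_covec_part: "linear covec_part"
proof -
  have "linear (\<lambda>z::'n::finite pvec. \<chi> i. pRe (z $ i) - pIm (z $ i))"
    by (rule linearI) (simp_all add: vec_eq_iff algebra_simps)
  then show ?thesis
    unfolding covec_part_def by (rule linear_compose[unfolded o_def]) simp
qed

lemma linear_of_parts: "linear (\<lambda>p. of_parts (fst p) (snd p))"
  by (rule linearI; rule parts_eqI)
    (simp_all add: linear_add[OF linear_vec_part] linear_add[OF linear_covec_part]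
      linear_cmul[OF linear_vec_part] linear_cmul[OF linear_covec_part])

lemmas bounded_linear_vec_part = linear_vec_part[unfolded linear_conv_bounded_linear]
lemmas bounded_linear_covec_part = linear_covec_part[unfolded linear_conv_bounded_linear]
lemmas bounded_linear_of_parts = linear_of_parts[unfolded linear_conv_bounded_linear]

lemmas part_simps =
  linear_add[OF linear_vec_part] linear_add[OF linear_covec_part]
  linear_diff[OF linear_vec_part] linear_diff[OF linear_covec_part]
  linear_neg[OF linear_vec_part] linear_neg[OF linear_covec_part]
  linear_cmul[OF linear_vec_part] linear_cmul[OF linear_covec_part]
  linear_0[OF linear_vec_part] linear_0[OF linear_covec_part]

lemma bounded_linear_of_covec: "bounded_linear (\<lambda>y. of_parts 0 y)"
  unfolding linear_conv_bounded_linear[symmetric]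
  by (rule linearI; rule parts_eqI; simp add: part_simps)

lemma bounded_linear_of_vec: "bounded_linear (\<lambda>x. of_parts x 0)"
  unfolding linear_conv_bounded_linear[symmetric]
  by (rule linearI; rule parts_eqI; simp add: part_simps)

lemma continuous_on_of_parts:
  assumes "continuous_on X f" "continuous_on X g"
  shows "continuous_on X (\<lambda>z. of_parts (f z) (g z))"
  using continuous_on_compose2[OF linear_continuous_on[OF bounded_linear_of_parts]
      continuous_on_Pair[OF assms] subset_UNIV] by simp

lemma bounded_bilinear_pairing: "bounded_bilinear pairing"
  unfolding pairing_def
  by (rule bounded_bilinear.comp[OF bounded_bilinear_inner bounded_linear_vec_part
        bounded_linear_covec_part])

lemmas pairing_simps =
  bounded_bilinear.add_left[OF bounded_bilinear_pairing]
  bounded_bilinear.add_right[OF bounded_bilinear_pairing]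
  bounded_bilinear.diff_left[OF bounded_bilinear_pairing]
  bounded_bilinear.diff_right[OF bounded_bilinear_pairing]
  bounded_bilinear.minus_left[OF bounded_bilinear_pairing]
  bounded_bilinear.minus_right[OF bounded_bilinear_pairing]
  bounded_bilinear.scaleR_left[OF bounded_bilinear_pairing]
  bounded_bilinear.scaleR_right[OF bounded_bilinear_pairing]
  bounded_bilinear.zero_left[OF bounded_bilinear_pairing]
  bounded_bilinear.zero_right[OF bounded_bilinear_pairing]

lemma pRe_sum: "pRe (sum f S) = (\<Sum>i\<in>S. pRe (f i))"
  by (induction S rule: infinite_finite_induct) simp_all

lemma pIm_sum: "pIm (sum f S) = (\<Sum>i\<in>S. pIm (f i))"
  by (induction S rule: infinite_finite_induct) simp_all

text \<open>
  The coefficients of \<open>e\<^sub>+\<close> and \<open>e\<^sub>-\<close> in \<open>qform z w\<close> are \<open>pairing z w\<close> and \<open>pairing w z\<close>.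
\<close>

lemma qform_pairing:
  "qform z w = Paracomplex ((pairing z w + pairing w z) / 2) ((pairing z w - pairing w z) / 2)"
proof -
  have zw: "pairing z w = (\<Sum>i\<in>UNIV. \<Sum>j\<in>UNIV.
      (pRe (z $ i) + pIm (z $ i)) * antidiag $ i $ j * (pRe (w $ j) - pIm (w $ j)))"
    by (simp add: pairing_def vec_part_def covec_part_def inner_vec_def matrix_vector_mult_def
        sum_distrib_left mult.assoc)
  have "pairing w z = (antidiag *v vec_part w) \<bullet> (antidiag *v covec_part z)"
    by (simp add: inner_antidiag pairing_def)
  also have "\<dots> = (\<chi> i. pRe (z $ i) - pIm (z $ i)) \<bullet> (antidiag *v vec_part w)"
    unfolding covec_part_def antidiag_vec_involution by (rule inner_commute)
  also have "\<dots> = (\<Sum>i\<in>UNIV. \<Sum>j\<in>UNIV.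
      (pRe (z $ i) - pIm (z $ i)) * antidiag $ i $ j * (pRe (w $ j) + pIm (w $ j)))"
    by (simp add: vec_part_def inner_vec_def matrix_vector_mult_def sum_distrib_left mult.assoc)
  finally have wz: "pairing w z = \<dots>" .
  show ?thesis
    unfolding qform_def zw wz paracomplex_eq_iff
    by (simp add: pRe_sum pIm_sum of_real_def pcnj_def sum_divide_distrib
        flip: sum.distrib sum_subtractf) (simp add: algebra_simps diff_divide_distrib)
qed

lemma pRe_qform: "pRe (qform z w) = (pairing z w + pairing w z) / 2"
  and pIm_qform: "pIm (qform z w) = (pairing z w - pairing w z) / 2"
  by (simp_all add: qform_pairing)

lemma in_quadric_iff: "z \<in> quadric \<longleftrightarrow> pairing z z = -1"
  by (auto simp: quadric_def paracomplex_eq_iff qform_pairing)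

lemma in_tangent_iff: "w \<in> tangent z \<longleftrightarrow> pairing w z = 0 \<and> pairing z w = 0"
  by (auto simp: tangent_def paracomplex_eq_iff qform_pairing)

lemma metric_g_pairing: "metric_g v w = (pairing v w + pairing w v) / 2"
  by (simp add: metric_g_def pRe_qform)

text \<open>
  Multiplication by \<open>\<tau>\<close> negates the covector part only.
\<close>

lemma omega_pairing: "omega v w = (pairing w v - pairing v w) / 2"
  by (simp add: omega_def metric_g_pairing pairing_def vec_part_unit_scale covec_part_unit_scale
      tau_def)

section \<open>Orbits of the unit group and the topology of the quotient\<close>

text \<open>
  A paracomplex number with coefficients \<open>a\<close> of \<open>e\<^sub>+\<close> and \<open>b\<close> of \<open>e\<^sub>-\<close> is a unit of norm one if and only
  if \<open>a b = 1\<close>.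
\<close>

lemma in_orbit_iff:
  "w \<in> orbit z \<longleftrightarrow> (\<exists>a. a \<noteq> 0 \<and> vec_part w = a *\<^sub>R vec_part z \<and> covec_part w = inverse a *\<^sub>R covec_part z)"
proof
  assume "w \<in> orbit z"
  then obtain u where u: "u \<in> unit_group" "w = u *s z" unfolding orbit_def by auto
  from u(1) have "(pRe u + pIm u) * (pRe u - pIm u) = 1"
    by (simp add: unit_group_def paracomplex_eq_iff pcnj_def algebra_simps)
  then have "pRe u + pIm u \<noteq> 0" "pRe u - pIm u = inverse (pRe u + pIm u)"
    by (auto simp: inverse_unique)
  then show "\<exists>a. a \<noteq> 0 \<and> vec_part w = a *\<^sub>R vec_part z \<and> covec_part w = inverse a *\<^sub>R covec_part z"
    unfolding u(2) vec_part_unit_scale covec_part_unit_scale by metis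
next
  assume "\<exists>a. a \<noteq> 0 \<and> vec_part w = a *\<^sub>R vec_part z \<and> covec_part w = inverse a *\<^sub>R covec_part z"
  then obtain a where a: "a \<noteq> 0" "vec_part w = a *\<^sub>R vec_part z"
    "covec_part w = inverse a *\<^sub>R covec_part z" by blast
  define u where "u = Paracomplex ((a + inverse a) / 2) ((a - inverse a) / 2)"
  have u: "pRe u + pIm u = a" "pRe u - pIm u = inverse a"
    by (simp_all add: u_def field_simps)
  have "(pRe u + pIm u) * (pRe u - pIm u) = 1" unfolding u using a(1) by simp
  then have "u \<in> unit_group"
    by (simp add: unit_group_def paracomplex_eq_iff pcnj_def algebra_simps)
  moreover have "w = u *s z"
    by (rule parts_eqI) (simp_all add: vec_part_unit_scale covec_part_unit_scale u a)
  ultimately show "w \<in> orbit z" unfolding orbit_def by blast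
qed

lemma orbit_self: "z \<in> orbit (z :: 'n::{finite,linorder} pvec)"
  by (auto simp: in_orbit_iff intro: exI[of _ 1])

lemma orbit_sym: "w \<in> orbit (z :: 'n::{finite,linorder} pvec) \<Longrightarrow> z \<in> orbit w"
  unfolding in_orbit_iff
proof (elim exE conjE)
  fix a :: real
  assume "a \<noteq> 0" "vec_part w = a *\<^sub>R vec_part z" "covec_part w = inverse a *\<^sub>R covec_part z"
  then show "\<exists>a. a \<noteq> 0 \<and> vec_part z = a *\<^sub>R vec_part w \<and> covec_part z = inverse a *\<^sub>R covec_part w"
    by (intro exI[of _ "inverse a"]) simp
qed

lemma orbit_trans: "v \<in> orbit w \<Longrightarrow> w \<in> orbit (z :: 'n::{finite,linorder} pvec) \<Longrightarrow> v \<in> orbit z"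
  unfolding in_orbit_iff
proof (elim exE conjE)
  fix a b :: real
  assume "a \<noteq> 0" "vec_part v = a *\<^sub>R vec_part w" "covec_part v = inverse a *\<^sub>R covec_part w"
    "b \<noteq> 0" "vec_part w = b *\<^sub>R vec_part z" "covec_part w = inverse b *\<^sub>R covec_part z"
  then show "\<exists>a. a \<noteq> 0 \<and> vec_part v = a *\<^sub>R vec_part z \<and> covec_part v = inverse a *\<^sub>R covec_part z"
    by (intro exI[of _ "a * b"]) simp
qed

lemma orbit_eq: "w \<in> orbit (z :: 'n::{finite,linorder} pvec) \<Longrightarrow> orbit w = orbit z"
  by (intro set_eqI iffI) (erule (1) orbit_trans, erule orbit_trans, erule orbit_sym)

lemma orbit_subset_quadric: "z \<in> quadric \<Longrightarrow> w \<in> orbit z \<Longrightarrow> w \<in> quadric"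
  unfolding in_orbit_iff
  by (elim exE conjE) (simp add: in_quadric_iff pairing_def)

lemma hyp_cases:
  assumes "S \<subseteq> hyp" "p \<in> S"
  obtains w where "p = orbit w" "w \<in> quadric"
  using assms unfolding hyp_def by (meson imageE subsetD)

lemma Union_hyp:
  assumes "S \<subseteq> hyp"
  shows "\<Union>S \<subseteq> quadric"
proof
  fix z assume "z \<in> \<Union>S"
  then obtain p where "z \<in> p" "p \<in> S" by (rule UnionE)
  moreover obtain w where "p = orbit w" "w \<in> quadric" by (rule hyp_cases[OF assms \<open>p \<in> S\<close>])
  ultimately show "z \<in> quadric" using orbit_subset_quadric[of w z] by simp
qed

lemma orbit_in_iff:
  assumes "S \<subseteq> hyp"
  shows "orbit z \<in> S \<longleftrightarrow> z \<in> \<Union>S"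
proof
  assume "z \<in> \<Union>S"
  then obtain p where "z \<in> p" "p \<in> S" by (rule UnionE)
  moreover obtain w where "p = orbit w" by (rule hyp_cases[OF assms \<open>p \<in> S\<close>])
  ultimately show "orbit z \<in> S" using orbit_eq[of z w] by simp
next
  assume "orbit z \<in> S"
  then show "z \<in> \<Union>S" using orbit_self by (rule UnionI)
qed

lemma eq_orbit_image:
  assumes "S \<subseteq> hyp"
  shows "S = orbit ` \<Union>S"
proof (intro set_eqI iffI)
  fix p assume "p \<in> S"
  obtain w where w: "p = orbit w" by (rule hyp_cases[OF assms \<open>p \<in> S\<close>])
  with \<open>p \<in> S\<close> have "w \<in> \<Union>S" by (simp only: orbit_in_iff[OF assms])
  then show "p \<in> orbit ` \<Union>S" unfolding w by (rule imageI)
next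
  fix p assume "p \<in> orbit ` \<Union>S"
  then obtain w where w: "p = orbit w" "w \<in> \<Union>S" by (rule imageE)
  then show "p \<in> S" by (simp only: orbit_in_iff[OF assms])
qed

lemma orbit_subset_Union:
  assumes "S \<subseteq> hyp" "z \<in> \<Union>S" "w \<in> orbit z"
  shows "w \<in> \<Union>S"
proof -
  have "orbit z \<in> S" using assms(2) by (simp only: orbit_in_iff[OF assms(1)])
  then show ?thesis using assms(3) by (rule UnionI)
qed

definition dilate :: "real \<Rightarrow> 'n::{finite,linorder} pvec \<Rightarrow> 'n pvec"
  where "dilate a z = of_parts (a *\<^sub>R vec_part z) (inverse a *\<^sub>R covec_part z)"

lemma in_orbit_dilate: "w \<in> orbit z \<longleftrightarrow> (\<exists>a. a \<noteq> 0 \<and> w = dilate a z)"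
  unfolding in_orbit_iff dilate_def by (metis of_parts_parts vec_part_of_parts covec_part_of_parts)

text \<open>
  The right-hand side defines a topology because distinct orbits are disjoint, so that
  unions of sets of orbits commute with finite intersections.
\<close>

lemma openin_hyp_topology:
  fixes W :: "'n::{finite,linorder} pvec set set"
  shows "openin hyp_topology W \<longleftrightarrow> W \<subseteq> hyp \<and> openin (top_of_set quadric) (\<Union>W)"
proof -
  have Int: "\<Union>(V \<inter> W) = \<Union>V \<inter> \<Union>W" if "V \<subseteq> hyp" "W \<subseteq> hyp" for V W :: "'n pvec set set"
  proof (rule set_eqI)
    fix z
    have "z \<in> \<Union>(V \<inter> W) \<longleftrightarrow> orbit z \<in> V \<inter> W"
      using that by (intro orbit_in_iff[symmetric]) (rule le_infI1)
    also have "\<dots> \<longleftrightarrow> z \<in> \<Union>V \<inter> \<Union>W"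
      by (simp only: Int_iff orbit_in_iff[OF that(1)] orbit_in_iff[OF that(2)])
    finally show "z \<in> \<Union>(V \<inter> W) \<longleftrightarrow> z \<in> \<Union>V \<inter> \<Union>W" .
  qed
  have "istopology (\<lambda>W. W \<subseteq> (hyp :: 'n pvec set set) \<and> openin (top_of_set quadric) (\<Union>W))"
    unfolding istopology_def
  proof (intro conjI allI impI)
    fix V W :: "'n pvec set set"
    assume V: "V \<subseteq> hyp \<and> openin (top_of_set quadric) (\<Union>V)"
      and W: "W \<subseteq> hyp \<and> openin (top_of_set quadric) (\<Union>W)"
    then show "V \<inter> W \<subseteq> hyp" by blast
    show "openin (top_of_set quadric) (\<Union>(V \<inter> W))"
      using V W Int[of V W] openin_Int[of "top_of_set quadric" "\<Union>V" "\<Union>W"] by simp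
  next
    fix \<K> :: "'n pvec set set set"
    assume \<K>: "\<forall>W\<in>\<K>. W \<subseteq> hyp \<and> openin (top_of_set quadric) (\<Union>W)"
    then show "\<Union>\<K> \<subseteq> hyp" by blast
    have "\<Union>(\<Union>\<K>) = \<Union>(Union ` \<K>)" by blast
    moreover have "openin (top_of_set quadric) (\<Union>(Union ` \<K>))"
      by (rule openin_Union) (use \<K> in blast)
    ultimately show "openin (top_of_set quadric) (\<Union>(\<Union>\<K>))" by simp
  qed
  then show ?thesis by (simp add: hyp_topology_def)
qed

section \<open>Positive definite matrices\<close>

lemma matrix_inv_inverse:
  fixes A :: "'n::finite rmat"
  assumes "det A \<noteq> 0"
  shows "A ** matrix_inv A = mat 1" "matrix_inv A ** A = mat 1"
proof -
  have "\<exists>B. A ** B = mat 1 \<and> B ** A = mat 1"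
    using assms by (simp add: invertible_det_nz flip: invertible_def)
  then have "A ** matrix_inv A = mat 1 \<and> matrix_inv A ** A = mat 1"
    unfolding matrix_inv_def by (rule someI_ex)
  then show "A ** matrix_inv A = mat 1" "matrix_inv A ** A = mat 1" by simp_all
qed

lemma matrix_inv_vec [simp]:
  fixes A :: "'n::finite rmat"
  assumes "det A \<noteq> 0"
  shows "A *v (matrix_inv A *v x) = x" "matrix_inv A *v (A *v x) = x"
  by (simp_all add: matrix_vector_mul_assoc matrix_inv_inverse[OF assms])

lemma det_nonzeroI:
  fixes A :: "'n::finite rmat"
  assumes "A ** B = mat 1"
  shows "det A \<noteq> 0"
proof -
  have "det A * det B = 1" using det_mul[of A B] assms by simp
  then show ?thesis by auto
qed

lemma matrix_inv_unique:
  fixes A :: "'n::finite rmat"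
  assumes "A ** B = mat 1"
  shows "matrix_inv A = B"
proof -
  have "matrix_inv A = (matrix_inv A ** A) ** B"
    using assms by (simp flip: matrix_mul_assoc)
  then show ?thesis by (simp add: matrix_inv_inverse(2)[OF det_nonzeroI[OF assms]])
qed

lemma inner_transpose: "x \<bullet> (transpose B *v y) = (B *v x) \<bullet> (y :: real ^ 'n)"
  using dot_lmul_matrix[of y B x] inner_commute[of x "y v* B"] inner_commute[of y "B *v x"] by simp

lemma det_scaleR: "det (c *\<^sub>R A) = c ^ CARD('n) * det (A :: 'n::finite rmat)"
proof -
  have "c *\<^sub>R A = (\<chi> i. c *s A $ i)"
    by (simp add: vec_eq_iff)
  then show ?thesis using det_rows_mul[of "\<lambda>i. c" "\<lambda>i. A $ i"] by simp
qed

definition posdef :: "'n::finite rmat \<Rightarrow> bool"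
  where "posdef P \<longleftrightarrow> transpose P = P \<and> (\<forall>x. x \<noteq> 0 \<longrightarrow> x \<bullet> (P *v x) > 0)"

lemma posdef_pos: "posdef P \<Longrightarrow> x \<noteq> 0 \<Longrightarrow> x \<bullet> (P *v x) > 0"
  by (simp add: posdef_def)

lemma posdef_sym: "posdef P \<Longrightarrow> x \<bullet> (P *v y) = y \<bullet> (P *v x)"
  using inner_transpose[of x P y] inner_commute[of "P *v x" y]
  by (simp only: posdef_def)

lemma posdef_scaleR: "posdef P \<Longrightarrow> c > 0 \<Longrightarrow> posdef (c *\<^sub>R P)"
  by (auto simp: posdef_def transpose_scalar simp flip: scaleR_matrix_vector_assoc)

text \<open>
  For invertible \<open>A\<close>, this is \<open>(A A\<^sup>t)\<^sup>-\<^sup>1\<close>, the matrix of the inner product for which the columns of \<open>A\<close>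
  are orthonormal.
\<close>

definition inverse_gram :: "'n::finite rmat \<Rightarrow> 'n rmat"
  where "inverse_gram A = transpose (matrix_inv A) ** matrix_inv A"

lemma inner_inverse_gram: "x \<bullet> (inverse_gram A *v y) = (matrix_inv A *v x) \<bullet> (matrix_inv A *v y)"
  by (simp only: inverse_gram_def inner_transpose flip: matrix_vector_mul_assoc)

lemma posdef_inverse_gram:
  assumes "det A \<noteq> 0"
  shows "posdef (inverse_gram A)"
  unfolding posdef_def
proof (intro conjI allI impI)
  show "transpose (inverse_gram A) = inverse_gram A"
    by (simp add: inverse_gram_def matrix_transpose_mul)
  fix x :: "real ^ 'a" assume "x \<noteq> 0"
  then have "matrix_inv A *v x \<noteq> 0" using matrix_inv_vec(1)[OF assms, of x] by auto
  then show "x \<bullet> (inverse_gram A *v x) > 0" by (simp add: inner_inverse_gram)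
qed

lemma inverse_gram_scaleR:
  fixes A :: "'n::finite rmat"
  assumes "c \<noteq> 0" "det A \<noteq> 0"
  shows "inverse_gram (c *\<^sub>R A) = (inverse c)\<^sup>2 *\<^sub>R inverse_gram A"
proof -
  have "matrix_inv (c *\<^sub>R A) = inverse c *\<^sub>R matrix_inv A"
    by (rule matrix_inv_unique)
      (simp add: matrix_scalar_ac scalar_matrix_assoc matrix_inv_inverse assms flip: scalar_mult_eq_scaleR)
  then show ?thesis
    by (simp add: inverse_gram_def transpose_scalar power2_eq_square
      matrix_scalar_ac flip: scalar_matrix_assoc)
qed

section \<open>Lagrangian negative definite planes and their traces\<close>

definition graph_plane :: "'n::{finite,linorder} rmat \<Rightarrow> 'n pvec set"
  where "graph_plane P = {z. covec_part z = - (P *v vec_part z)}"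

text \<open>
  On the plane \<open>y = - P x\<close> the points of the quadric are normalised by \<open>x \<bullet> P x = 1\<close>; the units undo this
  normalisation. What they sweep out is the graph of this function, which is homogeneous of degree \<open>-1\<close>
  and only depends on \<open>P\<close> up to a positive factor.
\<close>

definition trace_covec :: "'n::finite rmat \<Rightarrow> (real, 'n) vec \<Rightarrow> (real, 'n) vec"
  where "trace_covec P x = - inverse (x \<bullet> (P *v x)) *\<^sub>R (P *v x)"

lemma plane_trace_subset_hyp: "plane_trace V \<subseteq> hyp"
  by (auto simp: plane_trace_def hyp_def)

lemma Union_plane_trace:
  assumes "posdef P"
  shows "\<Union>(plane_trace (graph_plane P))
    = {z. vec_part z \<noteq> 0 \<and> covec_part z = trace_covec P (vec_part z)}"
  unfolding trace_covec_def
proof (intro set_eqI iffI)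
  fix w assume "w \<in> \<Union>(plane_trace (graph_plane P))"
  then obtain z where z: "covec_part z = - (P *v vec_part z)" "z \<in> quadric" "w \<in> orbit z"
    by (auto simp: plane_trace_def graph_plane_def)
  from z(3) obtain a where a: "a \<noteq> 0" "vec_part w = a *\<^sub>R vec_part z"
    "covec_part w = inverse a *\<^sub>R covec_part z" by (auto simp: in_orbit_iff)
  from z have one: "vec_part z \<bullet> (P *v vec_part z) = 1"
    by (simp add: in_quadric_iff pairing_def)
  then have "vec_part z \<noteq> 0" by auto
  with a one show "w \<in> {z. vec_part z \<noteq> 0 \<and>
      covec_part z = - inverse (vec_part z \<bullet> (P *v vec_part z)) *\<^sub>R (P *v vec_part z)}"
    by (simp add: z(1) matrix_vector_mult_scaleR)
next
  fix w assume "w \<in> {z. vec_part z \<noteq> 0 \<and>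
      covec_part z = - inverse (vec_part z \<bullet> (P *v vec_part z)) *\<^sub>R (P *v vec_part z)}"
  then have w: "vec_part w \<noteq> 0"
    "covec_part w = - inverse (vec_part w \<bullet> (P *v vec_part w)) *\<^sub>R (P *v vec_part w)" by auto
  define a where "a = sqrt (vec_part w \<bullet> (P *v vec_part w))"
  have a: "a > 0" "a * a = vec_part w \<bullet> (P *v vec_part w)"
    using posdef_pos[OF assms w(1)] by (simp_all add: a_def)
  define z where "z = of_parts (inverse a *\<^sub>R vec_part w) (a *\<^sub>R covec_part w)"
  have "w \<in> orbit z"
    using a(1) by (auto simp: in_orbit_iff z_def intro!: exI[of _ a])
  moreover have "z \<in> graph_plane P"
    using a(1) by (simp add: graph_plane_def z_def w(2) matrix_vector_mult_scaleR flip: a(2))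
  moreover have "z \<in> quadric"
    using a by (simp add: in_quadric_iff pairing_def z_def w(2) flip: a(2)) (simp add: field_simps)
  ultimately show "w \<in> \<Union>(plane_trace (graph_plane P))"
    by (auto simp: plane_trace_def)
qed

lemma plane_trace_eqI:
  "\<Union>(plane_trace V) = \<Union>(plane_trace W) \<Longrightarrow> plane_trace V = plane_trace W"
  using eq_orbit_image[OF plane_trace_subset_hyp[of V]] eq_orbit_image[OF plane_trace_subset_hyp[of W]]
  by (simp only:)

lemma plane_trace_scaleR:
  assumes "posdef P" "c > 0"
  shows "plane_trace (graph_plane (c *\<^sub>R P)) = plane_trace (graph_plane P)"
proof (rule plane_trace_eqI)
  show "\<Union>(plane_trace (graph_plane (c *\<^sub>R P))) = \<Union>(plane_trace (graph_plane P))"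
  proof -
    have "inverse (x \<bullet> ((c *\<^sub>R P) *v x)) *\<^sub>R ((c *\<^sub>R P) *v x)
        = inverse (x \<bullet> (P *v x)) *\<^sub>R (P *v x)" for x
    proof -
      have "inverse (c * q) * c = inverse q" for q :: real using assms(2) by (simp add: field_simps)
      then show ?thesis
        by (simp only: scaleR_matrix_vector_assoc[symmetric] inner_scaleR_right scaleR_scaleR)
    qed
    then show ?thesis
      by (simp only: Union_plane_trace[OF posdef_scaleR[OF assms]] Union_plane_trace[OF assms(1)]
          trace_covec_def scaleR_minus_left)
  qed
qed

lemma bounded_bilinear_metric_g: "bounded_bilinear metric_g"
proof -
  have "bilinear metric_g"
    unfolding bilinear_def
    by (auto intro!: linearI simp: metric_g_pairing pairing_simps field_simps)
  then show ?thesis by (simp add: bilinear_conv_bounded_bilinear)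
qed

lemmas metric_g_simps =
  bounded_bilinear.add_left[OF bounded_bilinear_metric_g]
  bounded_bilinear.add_right[OF bounded_bilinear_metric_g]
  bounded_bilinear.scaleR_left[OF bounded_bilinear_metric_g]
  bounded_bilinear.scaleR_right[OF bounded_bilinear_metric_g]
  bounded_bilinear.sum_left[OF bounded_bilinear_metric_g]
  bounded_bilinear.sum_right[OF bounded_bilinear_metric_g]

lemma metric_g_commute: "metric_g v w = metric_g w v"
  by (simp add: metric_g_pairing add.commute)

lemma lagrangian_neg_planesD:
  assumes "V \<in> lagrangian_neg_planes"
  shows "subspace V" "dim V = CARD('n::{finite,linorder})"
    and "\<And>v w. v \<in> V \<Longrightarrow> w \<in> V \<Longrightarrow> pairing v (w :: 'n pvec) = pairing w v"
    and "\<And>v. v \<in> V \<Longrightarrow> v \<noteq> 0 \<Longrightarrow> metric_g v v < 0"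
  using assms unfolding lagrangian_neg_planes_def by (auto simp: pIm_qform metric_g_def)

text \<open>
  Let \<open>A\<close> have the vector parts of the orthonormal basis as columns, and let the columns of \<open>Y\<close> be the
  negated covector parts. Isotropy turns orthonormality into \<open>A\<^sup>t Y = 1\<close>, so \<open>Y = A\<^sup>-\<^sup>t\<close>. Isotropy of \<open>z\<close>
  with the basis then gives \<open>Y\<^sup>t x = - A\<^sup>t y\<close>, that is \<open>y = - Y Y\<^sup>t x\<close>. Conversely a point of this graph
  is the combination of the basis with the coefficients \<open>Y\<^sup>t x\<close>.
\<close>

lemma lagrangian_plane_eq_graph:
  fixes u :: "'n \<Rightarrow> 'n::{finite,linorder} pvec"
  assumes "subspace V"
    and isotropic: "\<And>v w. v \<in> V \<Longrightarrow> w \<in> V \<Longrightarrow> pairing v w = pairing w v"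
    and u: "\<And>i. u i \<in> V"
    and orthonormal: "\<And>i j. metric_g (u i) (u j) = (if i = j then -1 else 0)"
  defines "A \<equiv> \<chi> k i. vec_part (u i) $ k"
  shows "det A \<noteq> 0" "V = graph_plane (inverse_gram A)"
proof -
  define Y where "Y = (\<chi> k i. - covec_part (u i) $ k)"
  have "vec_part (u i) \<bullet> covec_part (u j) = (if i = j then -1 else 0)" for i j
    using orthonormal[of i j] isotropic[OF u u, of i j]
    by (simp add: metric_g_pairing pairing_def split: if_splits)
  then have "transpose A ** Y = mat 1"
    by (simp add: vec_eq_iff matrix_matrix_mult_def mat_def transpose_def A_def Y_def inner_vec_def
        sum_negf)
  then have YA: "transpose Y ** A = mat 1"
    by (metis matrix_transpose_mul transpose_mat transpose_transpose)
  then have AY: "A ** transpose Y = mat 1" by (simp add: matrix_left_right_inverse)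
  then show "det A \<noteq> 0" by (rule det_nonzeroI)
  have gram: "inverse_gram A = Y ** transpose Y"
    by (simp add: inverse_gram_def matrix_inv_unique[OF AY])
  have YA': "Y ** transpose A = mat 1"
    using \<open>transpose A ** Y = mat 1\<close> by (simp add: matrix_left_right_inverse)
  show "V = graph_plane (inverse_gram A)"
  proof (intro set_eqI iffI)
    fix z assume "z \<in> V"
    have "transpose Y *v vec_part z = - (transpose A *v covec_part z)"
    proof (rule vec_eq_iff[THEN iffD2, rule_format])
      fix i
      have "vec_part z \<bullet> covec_part (u i) = vec_part (u i) \<bullet> covec_part z"
        using isotropic[OF \<open>z \<in> V\<close> u[of i]] by (simp add: pairing_def)
      then show "(transpose Y *v vec_part z) $ i = (- (transpose A *v covec_part z)) $ i"
        by (simp del: transpose_matrix_vector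
            add: matrix_vector_mult_def transpose_def A_def Y_def inner_vec_def sum_negf mult.commute)
    qed
    then have "Y *v (transpose Y *v vec_part z) = - ((Y ** transpose A) *v covec_part z)"
      by (simp del: transpose_matrix_vector add: matrix_vector_mul_assoc[symmetric] linear_neg)
    then show "z \<in> graph_plane (inverse_gram A)"
      by (simp del: transpose_matrix_vector
          add: graph_plane_def gram YA' matrix_vector_mul_assoc[symmetric])
  next
    fix z assume "z \<in> graph_plane (inverse_gram A)"
    then have z: "covec_part z = - (Y *v (transpose Y *v vec_part z))"
      by (simp del: transpose_matrix_vector
          add: graph_plane_def gram matrix_vector_mul_assoc[symmetric])
    define c where "c = transpose Y *v vec_part z"
    have "z = (\<Sum>i\<in>UNIV. c $ i *\<^sub>R u i)"
    proof (rule parts_eqI)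
      have "vec_part (\<Sum>i\<in>UNIV. c $ i *\<^sub>R u i) = A *v c"
        by (simp add: linear_sum[OF linear_vec_part] part_simps vec_eq_iff matrix_vector_mult_def
            A_def mult.commute)
      also have "\<dots> = vec_part z"
        unfolding c_def by (simp del: transpose_matrix_vector add: matrix_vector_mul_assoc AY)
      finally show "vec_part z = vec_part (\<Sum>i\<in>UNIV. c $ i *\<^sub>R u i)" ..
      have "covec_part (\<Sum>i\<in>UNIV. c $ i *\<^sub>R u i) = - (Y *v c)"
        by (simp add: linear_sum[OF linear_covec_part] part_simps vec_eq_iff matrix_vector_mult_def
            Y_def mult.commute sum_negf)
      then show "covec_part z = covec_part (\<Sum>i\<in>UNIV. c $ i *\<^sub>R u i)"
        unfolding z c_def by simp
    qed
    then show "z \<in> V" using u by (simp add: \<open>subspace V\<close> subspace_sum subspace_scale)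
  qed
qed

section \<open>Smooth passage between frames of planes and matrices\<close>

text \<open>
  The Gram-Schmidt process for the indefinite symmetric form \<open>metric_g\<close>. It can be carried out on a whole
  neighbourhood of \<open>Z0\<close>, frames or not, because the only condition, that the vectors to be normalised are
  negative, is open.
\<close>

lemma smooth_orthonormalisation:
  fixes Z0 :: "'n::{finite,linorder} pmat"
  assumes neg: "\<And>v. v \<in> span (rows Z0) \<Longrightarrow> v \<noteq> 0 \<Longrightarrow> metric_g v v < 0"
    and independent: "independent (rows Z0)" and inj: "inj (($) Z0)"
    and "finite I"
  shows "\<exists>U u. open U \<and> Z0 \<in> U \<and> (\<forall>i\<in>I. smooth_on_open U (u i)) \<and>
    (\<forall>Z\<in>U. \<forall>i\<in>I. u i Z \<in> span (($) Z ` I)) \<and>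
    (\<forall>Z\<in>U. \<forall>i\<in>I. \<forall>j\<in>I. metric_g (u i Z) (u j Z) = (if i = j then -1 else 0))"
  using \<open>finite I\<close>
proof induction
  case empty
  show ?case by (rule exI[of _ UNIV]) simp
next
  case (insert k I)
  then obtain U u where U: "open U" "Z0 \<in> U"
    and smooth: "\<And>i. i \<in> I \<Longrightarrow> smooth_on_open U (u i)"
    and span: "\<And>Z i. Z \<in> U \<Longrightarrow> i \<in> I \<Longrightarrow> u i Z \<in> span (($) Z ` I)"
    and ortho: "\<And>Z i j. Z \<in> U \<Longrightarrow> i \<in> I \<Longrightarrow> j \<in> I
      \<Longrightarrow> metric_g (u i Z) (u j Z) = (if i = j then -1 else 0)"
    by metis
  \<comment> \<open>A plus sign, because the vectors already constructed have square \<open>-1\<close>.\<close>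
  define w where "w Z = Z $ k + (\<Sum>j\<in>I. metric_g (Z $ k) (u j Z) *\<^sub>R u j Z)" for Z
  have smooth_w: "smooth_on_open U w"
    unfolding w_def
    by (intro smooth_on_open_add smooth_on_open_sum smooth_on_open_scaleR smooth
        smooth_on_open_bilinear[OF bounded_bilinear_metric_g]
        smooth_on_open_linear[OF _ bounded_linear_vec_nth] U)
  have span_w: "w Z \<in> span (($) Z ` insert k I)" if "Z \<in> U" for Z
    unfolding w_def using span[OF that]
    by (intro span_add span_sum span_scale) (auto intro: span_base subsetD[OF span_mono, rotated])
  have ortho_w: "metric_g (w Z) (u j Z) = 0" if "Z \<in> U" "j \<in> I" for Z j
  proof -
    have "(\<Sum>i\<in>I. metric_g (Z $ k) (u i Z) * metric_g (u i Z) (u j Z))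
        = (\<Sum>i\<in>I. if i = j then - metric_g (Z $ k) (u j Z) else 0)"
      by (rule sum.cong) (auto simp: ortho that)
    then show ?thesis using that insert.hyps by (simp add: w_def metric_g_simps)
  qed
  define W where "W = {Z \<in> U. metric_g (w Z) (w Z) < 0}"
  have "W = U \<inter> (\<lambda>Z. metric_g (w Z) (w Z)) -` {..<0}" by (auto simp: W_def)
  moreover have "continuous_on U (\<lambda>Z. metric_g (w Z) (w Z))"
    by (intro smooth_on_open_imp_continuous_on smooth_on_open_bilinear[OF bounded_bilinear_metric_g]
        smooth_w)
  ultimately have "open W" using continuous_open_preimage[OF _ U(1) open_lessThan] by metis
  have "W \<subseteq> U" by (auto simp: W_def)
  have rows: "rows Z0 = range (($) Z0)" by (auto simp: rows_def row_def)
  have "w Z0 \<noteq> 0"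
  proof
    assume "w Z0 = 0"
    then have "Z0 $ k = - (\<Sum>j\<in>I. metric_g (Z0 $ k) (u j Z0) *\<^sub>R u j Z0)"
      unfolding w_def by (simp add: eq_neg_iff_add_eq_0)
    also have "\<dots> \<in> span (($) Z0 ` I)"
      by (intro span_neg span_sum span_scale span U)
    also have "\<dots> \<subseteq> span (rows Z0 - {Z0 $ k})"
      using inj \<open>k \<notin> I\<close> by (intro span_mono) (auto simp: rows dest: injD)
    finally show False using independent by (auto simp: dependent_def rows)
  qed
  moreover have "w Z0 \<in> span (rows Z0)"
    using span_w[OF U(2)] span_mono[of "($) Z0 ` insert k I" "rows Z0"] by (auto simp: rows)
  ultimately have "Z0 \<in> W" using neg U(2) by (simp add: W_def)
  define v where "v Z = (- metric_g (w Z) (w Z)) powr (-1/2) *\<^sub>R w Z" for Z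
  have smooth_v: "smooth_on_open W v"
  proof -
    have sm: "smooth_on_open W w" by (rule smooth_on_open_subset[OF smooth_w \<open>W \<subseteq> U\<close> \<open>open W\<close>])
    have "smooth_on_open W (\<lambda>Z. - metric_g (w Z) (w Z))"
      by (intro smooth_on_open_linear_comp[OF bounded_linear_minus[OF bounded_linear_ident]]
          smooth_on_open_bilinear[OF bounded_bilinear_metric_g] sm)
    then show ?thesis unfolding v_def
      by (intro smooth_on_open_scaleR smooth_on_open_powr sm) (auto simp: W_def)
  qed
  have norm_v: "metric_g (v Z) (v Z) = -1" if "Z \<in> W" for Z
  proof -
    define q where "q = - metric_g (w Z) (w Z)"
    have "q > 0" using that by (simp add: W_def q_def)
    have "q powr (-1/2) * q powr (-1/2) = q powr (-1/2 + -1/2)" by (rule powr_add[symmetric])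
    also have "\<dots> = inverse q" using \<open>q > 0\<close> by (simp add: powr_minus)
    finally have "q powr (-1/2) * (q powr (-1/2) * q) = 1" using \<open>q > 0\<close>
      by (simp flip: mult.assoc)
    moreover have "metric_g (v Z) (v Z) = - (q powr (-1/2) * (q powr (-1/2) * q))"
      by (simp only: v_def metric_g_simps q_def[symmetric]) (simp add: q_def)
    ultimately show ?thesis by simp
  qed
  define u' where "u' = u(k := v)"
  show ?case
  proof (intro exI conjI ballI)
    show "open W" "Z0 \<in> W" by fact+
    fix i assume i: "i \<in> insert k I"
    show "smooth_on_open W (u' i)"
      using i smooth_v smooth_on_open_subset[OF smooth \<open>W \<subseteq> U\<close> \<open>open W\<close>] by (auto simp: u'_def)
    fix Z assume Z: "Z \<in> W"
    then have "Z \<in> U" using \<open>W \<subseteq> U\<close> by auto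
    show "u' i Z \<in> span (($) Z ` insert k I)"
    proof (cases "i = k")
      case True
      then show ?thesis using span_w[OF \<open>Z \<in> U\<close>] by (simp add: u'_def v_def span_scale)
    next
      case False
      then have "u i Z \<in> span (($) Z ` I)" using i span[OF \<open>Z \<in> U\<close>] by simp
      then have "u i Z \<in> span (($) Z ` insert k I)"
        using span_mono[of "($) Z ` I" "($) Z ` insert k I"] by blast
      with False show ?thesis by (simp add: u'_def)
    qed
    fix j assume j: "j \<in> insert k I"
    have vu: "metric_g (v Z) (u l Z) = 0" if "l \<in> I" for l
      using ortho_w[OF \<open>Z \<in> U\<close> that] by (simp add: v_def metric_g_simps)
    then have "metric_g (u l Z) (v Z) = 0" if "l \<in> I" for l
      using that metric_g_commute[of "u l Z" "v Z"] by simp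
    with vu show "metric_g (u' i Z) (u' j Z) = (if i = j then -1 else 0)"
      using i j ortho[OF \<open>Z \<in> U\<close>] norm_v[OF Z]
      by (auto simp: u'_def)
  qed
qed

lemma frames_rows:
  fixes Z :: "'n::{finite,linorder} pmat"
  assumes "Z \<in> frames"
  shows "inj (($) Z)" "independent (rows Z)"
proof -
  have rows: "rows Z = range (($) Z)" by (auto simp: rows_def row_def)
  have dim: "dim (rows Z) = CARD('n)"
    using assms lagrangian_neg_planesD(2)[of "span (rows Z)"] by (simp add: frames_def)
  moreover have "dim (rows Z) \<le> card (rows Z)"
    by (intro dim_le_card span_superset) (simp add: rows)
  moreover have "card (rows Z) \<le> CARD('n)" unfolding rows by (rule card_image_le) simp
  ultimately have card: "card (rows Z) = CARD('n)" by simp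
  then show "inj (($) Z)" by (intro eq_card_imp_inj_on) (simp_all add: rows)
  show "independent (rows Z)"
    by (rule card_le_dim_spanning[of _ "rows Z"]) (simp_all add: card dim span_superset, simp add: rows)
qed

text \<open>
  The matrix of an orthonormalised frame has to be divided by a root of its determinant. In odd dimension
  a negative determinant is no obstacle, as multiplication with \<open>-1\<close> changes its sign. The
  scalar rescales the associated positive definite matrix, which leaves the trace unchanged.
\<close>

lemma smooth_local_section:
  fixes Z0 :: "'n::{finite,linorder} pmat"
  assumes odd: "odd CARD('n)" and Z0: "Z0 \<in> frames"
  shows "\<exists>U h. open U \<and> Z0 \<in> U \<and> smooth_on_open U h \<and> (\<forall>Z \<in> U \<inter> frames. det (h Z) = 1 \<and>
    plane_trace (span (rows Z)) = plane_trace (graph_plane (inverse_gram (h Z))))"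
proof -
  have neg: "metric_g v v < 0" if "v \<in> span (rows Z0)" "v \<noteq> 0" for v
    using Z0 that by (auto simp: frames_def dest: lagrangian_neg_planesD(4))
  have "\<exists>U u. open U \<and> Z0 \<in> U \<and> (\<forall>i::'n\<in>UNIV. smooth_on_open U (u i)) \<and>
    (\<forall>Z\<in>U. \<forall>i\<in>UNIV. u i Z \<in> span (range (($) Z))) \<and>
    (\<forall>Z\<in>U. \<forall>i\<in>UNIV. \<forall>j\<in>UNIV. metric_g (u i Z) (u j Z) = (if i = j then -1 else 0))"
    by (rule smooth_orthonormalisation[OF _ frames_rows(2,1)[OF Z0]]) (use neg in simp_all)
  then obtain U and u :: "'n \<Rightarrow> 'n pmat \<Rightarrow> 'n pvec" where U: "open U" "Z0 \<in> U"
    and all: "\<forall>i\<in>UNIV. smooth_on_open U (u i)"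
      "\<forall>Z\<in>U. \<forall>i\<in>UNIV. u i Z \<in> span (range (($) Z))"
      "\<forall>Z\<in>U. \<forall>i\<in>UNIV. \<forall>j\<in>UNIV. metric_g (u i Z) (u j Z) = (if i = j then -1 else 0)"
    by - (elim exE conjE, rule that, assumption+)
  have smooth: "smooth_on_open U (u i)" for i
    using all(1) by simp
  have span: "u i Z \<in> span (range (($) Z))" if "Z \<in> U" for Z i
    using all(2) that by simp
  have ortho: "metric_g (u i Z) (u j Z) = (if i = j then -1 else 0)" if "Z \<in> U" for Z i j
    using all(3) that by simp
  define A :: "'n pmat \<Rightarrow> 'n rmat" where "A Z = (\<chi> k i. vec_part (u i Z) $ k)" for Z
  have smooth_A: "smooth_on_open U A"
    unfolding A_def by (intro smooth_on_open_vec_lambda smooth_on_open_nth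
        smooth_on_open_linear_comp[OF bounded_linear_vec_part] smooth U)
  have A: "det (A Z) \<noteq> 0" "span (rows Z) = graph_plane (inverse_gram (A Z))"
    if "Z \<in> U" "Z \<in> frames" for Z
  proof -
    have rows: "rows Z = range (($) Z)" by (auto simp: rows_def row_def)
    have isotropic: "pairing v w = pairing w v" if "v \<in> span (rows Z)" "w \<in> span (rows Z)" for v w
      using \<open>Z \<in> frames\<close> that by (auto simp: frames_def dest: lagrangian_neg_planesD(3))
    have "u i Z \<in> span (rows Z)" for i unfolding rows by (rule span[OF that(1)])
    note graph = lagrangian_plane_eq_graph[OF subspace_span isotropic this ortho[OF that(1)]]
    show "det (A Z) \<noteq> 0" "span (rows Z) = graph_plane (inverse_gram (A Z))"
      using graph by (simp_all add: A_def)
  qed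
  define s where "s = sgn (det (A Z0))"
  have s: "s * s = 1" "s ^ CARD('n) = s"
    using A(1)[OF U(2) Z0] odd by (auto simp: s_def sgn_if)
  \<comment> \<open>The sign of the determinant is constant near \<open>Z0\<close>.\<close>
  define W where "W = {Z \<in> U. s * det (A Z) > 0}"
  have smooth_det: "smooth_on_open U (\<lambda>Z. s * det (A Z))"
    by (intro smooth_on_open_mult smooth_on_open_const smooth_on_open_det smooth_A U)
  have "W = U \<inter> (\<lambda>Z. s * det (A Z)) -` {0<..}" by (auto simp: W_def)
  then have "open W"
    by (simp only: continuous_open_preimage[OF smooth_on_open_imp_continuous_on[OF smooth_det]
        U(1) open_greaterThan])
  have "W \<subseteq> U" by (auto simp: W_def)
  have "s * det (A Z0) > 0"
    using A(1)[OF U(2) Z0] by (simp add: s_def sgn_if)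
  then have "Z0 \<in> W" using U(2) by (simp add: W_def)
  define c where "c Z = s * (s * det (A Z)) powr (- 1 / real CARD('n))" for Z
  define h where "h Z = c Z *\<^sub>R A Z" for Z
  have smooth_h: "smooth_on_open W h"
    unfolding h_def c_def
    by (intro smooth_on_open_scaleR smooth_on_open_mult smooth_on_open_const smooth_on_open_powr
        smooth_on_open_subset[OF smooth_det \<open>W \<subseteq> U\<close> \<open>open W\<close>]
        smooth_on_open_subset[OF smooth_A \<open>W \<subseteq> U\<close> \<open>open W\<close>] \<open>open W\<close>) (simp add: W_def)
  have "det (h Z) = 1 \<and> plane_trace (span (rows Z)) = plane_trace (graph_plane (inverse_gram (h Z)))"
    if Z: "Z \<in> W \<inter> frames" for Z
  proof
    have pos: "s * det (A Z) > 0" using Z by (simp add: W_def)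
    have "((s * det (A Z)) powr (- 1 / real CARD('n))) ^ CARD('n)
        = (s * det (A Z)) powr (- 1 / real CARD('n) * real CARD('n))"
      using pos by (subst powr_powr[symmetric], subst powr_realpow) auto
    also have "\<dots> = inverse (s * det (A Z))" using pos by (simp add: powr_minus)
    finally have root: "c Z ^ CARD('n) = s * inverse (s * det (A Z))"
      by (simp only: c_def power_mult_distrib s(2))
    have "det (h Z) = inverse (s * det (A Z)) * (s * det (A Z))"
      by (simp only: h_def det_scaleR root) (simp only: ac_simps)
    also have "\<dots> = 1" using pos by (intro left_inverse) auto
    finally show "det (h Z) = 1" .
    have "c Z \<noteq> 0" using pos by (auto simp: c_def)
    have det: "det (A Z) \<noteq> 0" using pos by auto
    have "inverse_gram (h Z) = (inverse (c Z))\<^sup>2 *\<^sub>R inverse_gram (A Z)"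
      unfolding h_def by (rule inverse_gram_scaleR[OF \<open>c Z \<noteq> 0\<close> det])
    moreover have "(inverse (c Z))\<^sup>2 > 0" using \<open>c Z \<noteq> 0\<close> by simp
    ultimately have "plane_trace (graph_plane (inverse_gram (h Z)))
        = plane_trace (graph_plane (inverse_gram (A Z)))"
      by (simp only: plane_trace_scaleR[OF posdef_inverse_gram[OF det]])
    then show "plane_trace (span (rows Z)) = plane_trace (graph_plane (inverse_gram (h Z)))"
      using A(2)[of Z] Z \<open>W \<subseteq> U\<close> by auto
  qed
  with \<open>open W\<close> \<open>Z0 \<in> W\<close> smooth_h show ?thesis by blast
qed

lemma transpose_vec_inv [simp]:
  fixes A :: "'n::finite rmat"
  assumes "det A \<noteq> 0"
  shows "transpose A *v (transpose (matrix_inv A) *v x) = x"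
    "transpose (matrix_inv A) *v (transpose A *v x) = x"
  by (simp_all only: matrix_vector_mul_assoc flip: matrix_transpose_mul)
    (simp_all add: matrix_inv_inverse[OF assms] transpose_mat)

text \<open>
  For invertible \<open>A\<close> the rows \<open>(A e\<^sub>i, - A\<^sup>-\<^sup>t e\<^sub>i)\<close> are an orthogonal basis, with squares \<open>-1\<close>, of the graph of \<open>- A\<^sup>-\<^sup>t A\<^sup>-\<^sup>1\<close>.
\<close>

definition frame_of :: "'n::{finite,linorder} rmat \<Rightarrow> 'n pmat"
  where "frame_of A = (\<chi> i. of_parts (column i A) (- row i (matrix_inv A)))"

lemma span_frame_of:
  fixes A :: "'n::{finite,linorder} rmat"
  assumes "det A \<noteq> 0"
  shows "span (rows (frame_of A)) = graph_plane (inverse_gram A)"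
    and "dim (graph_plane (inverse_gram A)) = CARD('n)"
proof -
  define L where "L c = of_parts (A *v c) (- (transpose (matrix_inv A) *v c))" for c
  have linear: "linear L"
    unfolding L_def
    by (rule linearI; rule parts_eqI)
      (simp_all del: transpose_matrix_vector add: part_simps matrix_vector_right_distrib matrix_vector_mult_scaleR)
  have "rows (frame_of A) = L ` Basis"
  proof -
    have "rows (frame_of A) = range (\<lambda>i. frame_of A $ i)" by (auto simp: rows_def row_def)
    also have "\<dots> = range (\<lambda>i. L (axis i 1))"
      by (simp add: L_def frame_of_def matrix_vector_mult_basis del: transpose_matrix_vector)
    also have "\<dots> = L ` range (\<lambda>i. axis i 1)" by (simp only: image_image)
    also have "range (\<lambda>i. axis i 1 :: (real, 'n) vec) = Basis" by (auto simp: Basis_vec_def)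
    finally show ?thesis .
  qed
  then have span: "span (rows (frame_of A)) = range L"
    by (simp add: linear_span_image[OF linear])
  have range: "range L = graph_plane (inverse_gram A)"
  proof (intro set_eqI iffI)
    fix z assume "z \<in> range L"
    then show "z \<in> graph_plane (inverse_gram A)"
      by (auto simp del: transpose_matrix_vector simp: L_def graph_plane_def inverse_gram_def assms
          matrix_vector_mul_assoc[symmetric])
  next
    fix z assume "z \<in> graph_plane (inverse_gram A)"
    then have "z = L (matrix_inv A *v vec_part z)"
      by (intro parts_eqI) (simp_all del: transpose_matrix_vector add: L_def graph_plane_def inverse_gram_def
          matrix_vector_mul_assoc[symmetric] matrix_inv_vec[OF assms])
    then show "z \<in> range L" by blast
  qed
  show "span (rows (frame_of A)) = graph_plane (inverse_gram A)" using span range by simp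
  have "inj L"
  proof (rule injI)
    fix c d assume "L c = L d"
    then have "A *v c = A *v d" by (metis L_def vec_part_of_parts)
    then show "c = d" by (metis matrix_inv_vec(2)[OF assms])
  qed
  then have "dim (range L) = dim (UNIV :: (real, 'n) vec set)" by (intro dim_image_eq linear) simp
  then show "dim (graph_plane (inverse_gram A)) = CARD('n)" by (simp add: range)
qed

lemma graph_plane_lagrangian:
  fixes A :: "'n::{finite,linorder} rmat"
  assumes "det A \<noteq> 0"
  shows "graph_plane (inverse_gram A) \<in> lagrangian_neg_planes"
proof -
  let ?P = "inverse_gram A" and ?V = "graph_plane (inverse_gram A)"
  note P = posdef_inverse_gram[OF assms]
  have "subspace ?V" unfolding span_frame_of(1)[OF assms, symmetric] by (rule subspace_span)
  moreover have "pIm (qform v w) = 0" if "v \<in> ?V" "w \<in> ?V" for v w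
    using that posdef_sym[OF P, of "vec_part v" "vec_part w"]
    by (simp add: pIm_qform pairing_def graph_plane_def)
  moreover have "pRe (qform v v) < 0" if "v \<in> ?V" "v \<noteq> 0" for v
  proof -
    have "vec_part v \<noteq> 0"
      using that parts_eqI[of v 0] by (auto simp: graph_plane_def part_simps)
    then show ?thesis
      using that(1) posdef_pos[OF P, of "vec_part v"]
      by (simp add: pRe_qform pairing_def graph_plane_def)
  qed
  ultimately show ?thesis
    by (simp add: lagrangian_neg_planes_def span_frame_of(2)[OF assms])
qed

lemma frame_of_in_frames: "det A \<noteq> 0 \<Longrightarrow> frame_of A \<in> frames"
  by (simp add: frames_def span_frame_of graph_plane_lagrangian)

text \<open>
  Cramer's rule: on matrices of determinant \<open>1\<close> the inverse is polynomial. This supplies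
  the extension to all matrices which smoothness on \<open>SL\<close> asks for.
\<close>

lemma matrix_inv_nth_det_1:
  fixes A :: "'n::finite rmat"
  assumes "det A = 1"
  shows "matrix_inv A $ k $ l = det (\<chi> i j. if j = k then mat 1 $ i $ l else A $ i $ j)"
proof -
  have "matrix_inv A *v axis l 1 = (\<chi> k. det (\<chi> i j. if j = k then axis l 1 $ i else A $ i $ j) / det A)"
    using cramer[of A "matrix_inv A *v axis l 1" "axis l 1"] assms by simp
  then have "column l (matrix_inv A) $ k = det (\<chi> i j. if j = k then axis l 1 $ i else A $ i $ j)"
    by (simp add: assms matrix_vector_mult_basis)
  moreover have "mat 1 $ i $ l = axis l (1::real) $ i" for i by (simp add: mat_def axis_def)
  ultimately show ?thesis by (simp add: column_def cong: if_cong)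
qed

lemma smooth_frame_of: "smooth_on_subset (SL \<inter> U) (frame_of :: 'n::{finite,linorder} rmat \<Rightarrow> 'n pmat)"
proof -
  define f :: "'n rmat \<Rightarrow> 'n pmat" where
    "f A = (\<chi> k. of_parts (\<chi> l. A $ l $ k) 0
      + of_parts 0 (\<chi> l. - 1 * det (\<chi> i j. if j = k then mat 1 $ i $ l else A $ i $ j)))" for A
  have entry: "smooth_on_open UNIV (\<lambda>A::'n rmat. A $ i $ j)" for i j
    by (rule smooth_on_open_nth, rule smooth_on_open_linear[OF open_UNIV bounded_linear_vec_nth])
  have "smooth_on_open UNIV (\<lambda>A::'n rmat. if j = k then mat 1 $ i $ l else A $ i $ j)" for i j k l
    using entry[of i j] by (cases "j = k") (simp_all add: smooth_on_open_const)
  then have cofactor: "smooth_on_open UNIV (\<lambda>A::'n rmat. \<chi> l. - 1 * det (\<chi> i j. if j = k then mat 1 $ i $ l else A $ i $ j))" for k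
    by (intro smooth_on_open_vec_lambda[OF open_UNIV]
        smooth_on_open_mult[OF smooth_on_open_const[OF open_UNIV]] smooth_on_open_det[OF open_UNIV])
  have column: "smooth_on_open UNIV (\<lambda>A::'n rmat. \<chi> l. A $ l $ k)" for k
    by (rule smooth_on_open_vec_lambda[OF open_UNIV entry])
  have split: "of_parts x y = of_parts x 0 + (of_parts 0 y :: 'n pvec)" for x y
    by (rule parts_eqI) (simp_all add: part_simps)
  have "smooth_on_open UNIV f"
    unfolding f_def
    by (rule smooth_on_open_vec_lambda[OF open_UNIV smooth_on_open_add[OF
        smooth_on_open_linear_comp[OF bounded_linear_of_vec column] smooth_on_open_linear_comp[OF bounded_linear_of_covec cofactor]]])
  moreover have "f A = frame_of A" if "A \<in> SL" for A
  proof -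
    have "(\<chi> l. A $ l $ k) = column k A" for k
      by (simp add: column_def)
    moreover have "(\<chi> l. - 1 * det (\<chi> i j. if j = k then mat 1 $ i $ l else A $ i $ j))
        = - row k (matrix_inv A)" for k
    proof (rule vec_eq_iff[THEN iffD2, rule_format])
      fix l
      have "matrix_inv A $ k $ l = det (\<chi> i j. if j = k then mat 1 $ i $ l else A $ i $ j)"
        using that by (intro matrix_inv_nth_det_1) (simp add: SL_def)
      then show "(\<chi> l. - 1 * det (\<chi> i j. if j = k then mat 1 $ i $ l else A $ i $ j)) $ l
          = (- row k (matrix_inv A)) $ l"
        by (simp add: row_def)
    qed
    ultimately show ?thesis by (simp only: f_def frame_of_def flip: split)
  qed
  ultimately show ?thesis unfolding smooth_on_subset_def by blast
qed

section \<open>Geometry of the traces\<close>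

lemma smooth_on_open_trace_covec:
  assumes "posdef P" and f: "smooth_on_open U f" and "\<And>z. z \<in> U \<Longrightarrow> f z \<noteq> 0"
  shows "smooth_on_open U (\<lambda>z. trace_covec P (f z))"
proof -
  have Pf: "smooth_on_open U (\<lambda>z. P *v f z)"
    using smooth_on_open_linear_comp[OF matrix_vector_mul_bounded_linear f] .
  have "smooth_on_open U (\<lambda>z. inverse (f z \<bullet> (P *v f z)) *\<^sub>R (P *v f z))"
    by (intro smooth_on_open_scaleR smooth_on_open_inverse smooth_on_open_inner f Pf)
      (simp add: posdef_pos[OF assms(1)] assms(3))
  from smooth_on_open_linear_comp[OF bounded_linear_minus[OF bounded_linear_ident] this]
  show ?thesis by (simp add: trace_covec_def)
qed

lemma continuous_on_trace_covec: "posdef P \<Longrightarrow> continuous_on (- {0}) (trace_covec P)"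
  by (intro smooth_on_open_imp_continuous_on[OF smooth_on_open_trace_covec] smooth_on_open_linear) auto

text \<open>
  As the preimage of the trace is a graph over the nonzero vectors, the shear that subtracts the function
  flattens it. One slice chart suffices.
\<close>

lemma trace_submanifold:
  fixes P :: "'n::{finite,linorder} rmat"
  assumes P: "posdef P"
  shows "submanifold (CARD('n)) (\<Union>(plane_trace (graph_plane P)))"
  unfolding submanifold_def
proof (intro ballI exI conjI)
  let ?M = "\<Union>(plane_trace (graph_plane P))"
  fix z assume "z \<in> ?M"
  define U where "U = {z :: 'n pvec. vec_part z \<noteq> 0}"
  define shift where "shift z = of_parts 0 (trace_covec P (vec_part z))" for z
  define E where "E = {z :: 'n pvec. covec_part z = 0}"
  have "open U"
    unfolding U_def
    by (rule open_Collect_neq[OF linear_continuous_on[OF bounded_linear_vec_part] continuous_on_const])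
  have smooth_shift: "smooth_on_open U shift"
    unfolding shift_def
    by (intro smooth_on_open_linear_comp[OF bounded_linear_of_covec]
        smooth_on_open_trace_covec[OF P] smooth_on_open_linear[OF \<open>open U\<close> bounded_linear_vec_part])
      (simp add: U_def)
  have ident: "smooth_on_open U (\<lambda>z. z)"
    by (rule smooth_on_open_linear[OF \<open>open U\<close> bounded_linear_ident])
  show phi: "smooth_on_open U (\<lambda>z. z - shift z)" and psi: "smooth_on_open U (\<lambda>z. z + shift z)"
    by (rule smooth_on_open_diff[OF ident smooth_shift] smooth_on_open_add[OF ident smooth_shift])+
  show "z \<in> U" using \<open>z \<in> ?M\<close> by (simp add: U_def Union_plane_trace[OF P])
  have vec: "vec_part (z - shift z) = vec_part z" "vec_part (z + shift z) = vec_part z" for z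
    by (simp_all add: part_simps shift_def)
  then have shift_eq: "shift (z - shift z) = shift z" "shift (z + shift z) = shift z" for z
    by (simp_all add: shift_def)
  have inv: "(z - shift z) + shift (z - shift z) = z" "(z + shift z) - shift (z + shift z) = z" for z
    by (simp_all add: shift_eq)
  have mem: "z - shift z \<in> U \<longleftrightarrow> z \<in> U" "z + shift z \<in> U \<longleftrightarrow> z \<in> U" for z
    by (simp_all add: U_def vec)
  show "homeomorphism U U (\<lambda>z. z - shift z) (\<lambda>z. z + shift z)"
    by (rule homeomorphismI[OF smooth_on_open_imp_continuous_on[OF phi]
          smooth_on_open_imp_continuous_on[OF psi]]) (auto simp: mem inv)
  show "subspace E"
    by (auto simp: subspace_def E_def part_simps)
  have "E = range (\<lambda>x. of_parts x 0)"
  proof (intro set_eqI iffI)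
    fix z :: "'n pvec" assume "z \<in> E"
    then have "z = of_parts (vec_part z) 0" by (intro parts_eqI) (simp_all add: E_def)
    then show "z \<in> range (\<lambda>x. of_parts x 0)" by blast
  qed (auto simp: E_def)
  moreover have "inj (\<lambda>x. of_parts x 0 :: 'n pvec)"
    by (rule injI) (metis vec_part_of_parts)
  ultimately have "dim E = dim (UNIV :: (real, 'n) vec set)"
    using dim_image_eq[OF bounded_linear.linear[OF bounded_linear_of_vec], of "UNIV :: (real, 'n) vec set"]
    by simp
  then show "dim E = CARD('n)" by simp
  show "(\<lambda>z. z - shift z) ` (?M \<inter> U) = E \<inter> U"
  proof (intro set_eqI iffI)
    fix w assume "w \<in> (\<lambda>z. z - shift z) ` (?M \<inter> U)"
    then obtain z where w: "w = z - shift z" and z: "z \<in> ?M" "z \<in> U" by blast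
    have "w \<in> U" using z(2) by (simp add: w mem)
    moreover have "covec_part w = 0"
      using z(1) by (simp add: w part_simps shift_def Union_plane_trace[OF P])
    ultimately show "w \<in> E \<inter> U" by (simp add: E_def)
  next
    fix w assume w: "w \<in> E \<inter> U"
    then have "w + shift w \<in> ?M"
      by (simp only: Union_plane_trace[OF P] vec mem_Collect_eq)
        (simp add: E_def U_def part_simps shift_def)
    moreover have "w + shift w \<in> U" using w by (simp add: mem)
    moreover have "w = (w + shift w) - shift (w + shift w)" by (simp add: inv)
    ultimately show "w \<in> (\<lambda>z. z - shift z) ` (?M \<inter> U)" by blast
  qed
qed

lemma derivative_of_constant:
  assumes "(f has_vector_derivative d) (at t)" "\<And>t. f t = c"
  shows "d = 0"
proof -
  have "f = (\<lambda>t. c)" using assms(2) by auto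
  with assms(1) show ?thesis
    using vector_derivative_unique_at has_vector_derivative_const by blast
qed

text \<open>
  Differentiate \<open>(x \<bullet> P x) y + P x = 0\<close> along a curve. The derivative of the scalar factor vanishes because
  horizontality means \<open>v \<bullet> P x = 0\<close> for the vector part \<open>v\<close> of the velocity. So the tangent vectors lie in
  the graph of \<open>- P / (x \<bullet> P x)\<close>, whence the trace is Lagrangian and negative definite.
\<close>

lemma trace_tangent:
  fixes P :: "'n::{finite,linorder} rmat"
  assumes P: "posdef P" and z: "z \<in> \<Union>(plane_trace (graph_plane P))"
    and v: "v \<in> tangent_sub (plane_trace (graph_plane P)) z"
  shows "covec_part v = - inverse (vec_part z \<bullet> (P *v vec_part z)) *\<^sub>R (P *v vec_part v)"
proof -
  let ?q = "vec_part z \<bullet> (P *v vec_part z)"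
  have x: "vec_part z \<noteq> 0" and y: "covec_part z = - inverse ?q *\<^sub>R (P *v vec_part z)"
    using z by (simp_all add: Union_plane_trace[OF P] trace_covec_def)
  have q: "?q > 0" by (rule posdef_pos[OF P x])
  from v obtain \<gamma> where \<gamma>: "\<And>t::real. \<gamma> t \<in> \<Union>(plane_trace (graph_plane P))" "\<gamma> 0 = z"
    "(\<gamma> has_vector_derivative v) (at 0)" and tan: "v \<in> tangent z"
    unfolding tangent_sub_def velocities_def by blast
  define x y where "x t = vec_part (\<gamma> t)" and "y t = covec_part (\<gamma> t)" for t
  have dx: "(x has_vector_derivative vec_part v) (at 0)"
    unfolding x_def using bounded_linear.has_vector_derivative[OF bounded_linear_vec_part \<gamma>(3)] .
  have dy: "(y has_vector_derivative covec_part v) (at 0)"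
    unfolding y_def using bounded_linear.has_vector_derivative[OF bounded_linear_covec_part \<gamma>(3)] .
  have dPx: "((\<lambda>t. P *v x t) has_vector_derivative P *v vec_part v) (at 0)"
    using bounded_linear.has_vector_derivative[OF matrix_vector_mul_bounded_linear dx] .
  have dq: "((\<lambda>t. x t \<bullet> (P *v x t)) has_vector_derivative
      x 0 \<bullet> (P *v vec_part v) + vec_part v \<bullet> (P *v x 0)) (at 0)"
    using bounded_bilinear.has_vector_derivative[OF bounded_bilinear_inner dx dPx] .
  have derivative: "((\<lambda>t. (x t \<bullet> (P *v x t)) *\<^sub>R y t + P *v x t) has_vector_derivative
      (x 0 \<bullet> (P *v x 0)) *\<^sub>R covec_part v
      + (x 0 \<bullet> (P *v vec_part v) + vec_part v \<bullet> (P *v x 0)) *\<^sub>R y 0 + P *v vec_part v) (at 0)"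
    by (intro has_vector_derivative_add dPx
        bounded_bilinear.has_vector_derivative[OF bounded_bilinear_scaleR dq dy])
  have "(x t \<bullet> (P *v x t)) *\<^sub>R y t + P *v x t = 0" for t
  proof -
    have "x t \<noteq> 0" "y t = - inverse (x t \<bullet> (P *v x t)) *\<^sub>R (P *v x t)"
      using \<gamma>(1)[of t] by (simp_all add: Union_plane_trace[OF P] trace_covec_def x_def y_def)
    then show ?thesis using posdef_pos[OF P, of "x t"] by simp
  qed
  then have "(x 0 \<bullet> (P *v x 0)) *\<^sub>R covec_part v
      + (x 0 \<bullet> (P *v vec_part v) + vec_part v \<bullet> (P *v x 0)) *\<^sub>R y 0 + P *v vec_part v = 0"
    by (rule derivative_of_constant[OF derivative])
  moreover have "vec_part v \<bullet> (P *v x 0) = 0"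
    using tan q y by (simp add: in_tangent_iff pairing_def x_def \<gamma>(2))
  moreover have "x 0 \<bullet> (P *v vec_part v) = vec_part v \<bullet> (P *v x 0)" by (rule posdef_sym[OF P])
  ultimately have "?q *\<^sub>R covec_part v = - (P *v vec_part v)"
    by (simp add: x_def \<gamma>(2) eq_neg_iff_add_eq_0)
  then have "inverse ?q *\<^sub>R (?q *\<^sub>R covec_part v) = - inverse ?q *\<^sub>R (P *v vec_part v)" by simp
  then show ?thesis using q by simp
qed

lemma trace_lagrangian:
  fixes P :: "'n::{finite,linorder} rmat"
  assumes P: "posdef P"
  shows "lagrangian (plane_trace (graph_plane P))"
  unfolding lagrangian_def hyp_submanifold_def
proof (intro conjI ballI)
  show "plane_trace (graph_plane P) \<subseteq> hyp" by (rule plane_trace_subset_hyp)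
  show "submanifold (CARD('n) - 1 + 1) (\<Union>(plane_trace (graph_plane P)))"
    using trace_submanifold[OF P] by simp
next
  fix z v w assume z: "z \<in> \<Union>(plane_trace (graph_plane P))"
    and v: "v \<in> tangent_sub (plane_trace (graph_plane P)) z"
    and w: "w \<in> tangent_sub (plane_trace (graph_plane P)) z"
  show "omega v w = 0"
    unfolding omega_pairing pairing_def trace_tangent[OF P z v] trace_tangent[OF P z w]
    using posdef_sym[OF P, of "vec_part v" "vec_part w"] by simp
qed

lemma trace_neg_definite:
  fixes P :: "'n::{finite,linorder} rmat"
  assumes P: "posdef P"
  shows "neg_definite (plane_trace (graph_plane P))"
  unfolding neg_definite_def
proof (intro ballI impI)
  fix z v assume z: "z \<in> \<Union>(plane_trace (graph_plane P))"
    and v: "v \<in> tangent_sub (plane_trace (graph_plane P)) z" and "v \<noteq> 0"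
  note covec = trace_tangent[OF P z v]
  have "vec_part z \<noteq> 0" using z by (simp add: Union_plane_trace[OF P])
  moreover have "vec_part v \<noteq> 0"
    using covec \<open>v \<noteq> 0\<close> parts_eqI[of v 0] by (auto simp: part_simps)
  ultimately show "metric_g v v < 0"
    using posdef_pos[OF P, of "vec_part z"] posdef_pos[OF P, of "vec_part v"]
    by (simp add: metric_g_pairing pairing_def covec)
qed

text \<open>
  Differentiating \<open>q(\<gamma>, \<gamma>) = -1\<close> and \<open>q(\<gamma>', \<gamma>) = 0\<close> gives \<open>q(\<gamma>'', \<gamma>) = - q(\<gamma>', \<gamma>')\<close>, so the geodesic equation
  reads \<open>\<gamma>'' = q(\<gamma>', \<gamma>') \<gamma>\<close>. This in turn shows that the speed \<open>q(\<gamma>', \<gamma>')\<close> is constant.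
\<close>

lemma geodesic_equation:
  fixes \<gamma> :: "real \<Rightarrow> 'n::{finite,linorder} pvec"
  assumes "geodesic \<gamma>"
  shows "\<exists>\<gamma>'. \<forall>t. (\<gamma> has_vector_derivative \<gamma>' t) (at t) \<and>
    (\<gamma>' has_vector_derivative pairing (\<gamma>' 0) (\<gamma>' 0) *\<^sub>R \<gamma> t) (at t)"
proof -
  from assms obtain \<gamma>' \<gamma>'' where quadric: "\<And>t. \<gamma> t \<in> quadric"
    and d1: "\<And>t. (\<gamma> has_vector_derivative \<gamma>' t) (at t)"
    and d2: "\<And>t. (\<gamma>' has_vector_derivative \<gamma>'' t) (at t)"
    and tangent: "\<And>t. \<gamma>' t \<in> tangent (\<gamma> t)"
    and eq: "\<And>t. \<gamma>'' t + qform (\<gamma>'' t) (\<gamma> t) *s \<gamma> t = 0"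
    unfolding geodesic_def by metis
  note product = bounded_bilinear.has_vector_derivative[OF bounded_bilinear_pairing]
  have tan: "pairing (\<gamma>' t) (\<gamma> t) = 0" "pairing (\<gamma> t) (\<gamma>' t) = 0" for t
    using tangent[of t] by (simp_all add: in_tangent_iff)
  have "pairing (\<gamma>' t) (\<gamma>' t) + pairing (\<gamma>'' t) (\<gamma> t) = 0" for t
    by (rule derivative_of_constant[OF product[OF d2 d1, of t] tan(1)])
  moreover have "pairing (\<gamma> t) (\<gamma>'' t) + pairing (\<gamma>' t) (\<gamma>' t) = 0" for t
    by (rule derivative_of_constant[OF product[OF d1 d2, of t] tan(2)])
  ultimately have "qform (\<gamma>'' t) (\<gamma> t) = Paracomplex (- pairing (\<gamma>' t) (\<gamma>' t)) 0" for t
    by (simp add: qform_pairing add_eq_0_iff)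
  moreover have "Paracomplex a 0 *s z = a *\<^sub>R z" for a and z :: "'n pvec"
    by (simp add: vec_eq_iff paracomplex_eq_iff)
  ultimately have \<gamma>'': "\<gamma>'' t = pairing (\<gamma>' t) (\<gamma>' t) *\<^sub>R \<gamma> t" for t
    using eq[of t] by simp
  have "((\<lambda>t. pairing (\<gamma>' t) (\<gamma>' t)) has_vector_derivative 0) (at t)" for t
    using product[OF d2 d2, of t] by (simp add: \<gamma>'' pairing_simps tan)
  then have const: "pairing (\<gamma>' t) (\<gamma>' t) = pairing (\<gamma>' 0) (\<gamma>' 0)" for t
    using has_vector_derivative_zero_constant[of UNIV "\<lambda>t. pairing (\<gamma>' t) (\<gamma>' t)"]
    by (metis UNIV_I convex_UNIV)
  have "(\<gamma>' has_vector_derivative pairing (\<gamma>' 0) (\<gamma>' 0) *\<^sub>R \<gamma> t) (at t)" for t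
    using d2[of t] by (simp only: \<gamma>''[of t] const[of t])
  with d1 show ?thesis by blast
qed

text \<open>
  Conservation of the energy \<open>u' \<bullet> u' - k (u \<bullet> u)\<close>, both of whose terms are nonnegative.
\<close>

lemma linear_ode_zero:
  fixes u u' :: "real \<Rightarrow> 'a::real_inner"
  assumes d1: "\<And>t. (u has_vector_derivative u' t) (at t)"
    and d2: "\<And>t. (u' has_vector_derivative k *\<^sub>R u t) (at t)"
    and "k \<le> 0" "u 0 = 0" "u' 0 = 0"
  shows "u t = 0"
proof -
  note product = bounded_bilinear.has_vector_derivative[OF bounded_bilinear_inner]
  have "((\<lambda>t. u' t \<bullet> u' t - k * (u t \<bullet> u t)) has_vector_derivative
      (u' t \<bullet> (k *\<^sub>R u t) + (k *\<^sub>R u t) \<bullet> u' t) - k * (u t \<bullet> u' t + u' t \<bullet> u t)) (at t)" for t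
    by (intro has_vector_derivative_diff product[OF d2 d2] product[OF d1 d1]
        bounded_linear.has_vector_derivative[OF bounded_linear_mult_right])
  then have "((\<lambda>t. u' t \<bullet> u' t - k * (u t \<bullet> u t)) has_vector_derivative 0) (at t)" for t
    by (simp add: inner_commute algebra_simps)
  then obtain c where c: "\<And>t. u' t \<bullet> u' t - k * (u t \<bullet> u t) = c"
    using has_vector_derivative_zero_constant[of UNIV "\<lambda>t. u' t \<bullet> u' t - k * (u t \<bullet> u t)"] by auto
  have "c = 0" using c[of 0] assms(4,5) by simp
  then have "u' t \<bullet> u' t = k * (u t \<bullet> u t)" for t using c[of t] by simp
  then have "u' t \<bullet> u' t \<le> 0" for t
    using \<open>k \<le> 0\<close> by (simp add: mult_nonpos_nonneg)
  then have "u' t \<bullet> u' t = 0" for t by (rule order_antisym) simp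
  then have "u' t = 0" for t by simp
  then have "(u has_vector_derivative 0) (at t)" for t using d1[of t] by simp
  then obtain c where "\<And>t. u t = c"
    using has_vector_derivative_zero_constant[of UNIV u] by auto
  then show ?thesis using \<open>u 0 = 0\<close> by metis
qed

text \<open>
  The initial point and the initial velocity lie in a plane \<open>y = - c P x\<close> with \<open>c > 0\<close>, and a linear map
  vanishing on the plane vanishes along the geodesic, which solves a linear equation. This plane has the
  same trace as \<open>y = - P x\<close>.
\<close>

lemma trace_totally_geodesic:
  fixes P :: "'n::{finite,linorder} rmat"
  assumes P: "posdef P"
  shows "totally_geodesic (plane_trace (graph_plane P))"
  unfolding totally_geodesic_def
proof (intro allI impI, elim conjE)
  let ?S = "plane_trace (graph_plane P)"
  fix \<gamma> t assume "geodesic \<gamma>" and z: "\<gamma> 0 \<in> \<Union>?S"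
    and v: "vector_derivative \<gamma> (at 0) \<in> tangent_sub ?S (\<gamma> 0)"
  obtain \<gamma>' where d1: "\<And>t. (\<gamma> has_vector_derivative \<gamma>' t) (at t)"
    and d2: "\<And>t. (\<gamma>' has_vector_derivative pairing (\<gamma>' 0) (\<gamma>' 0) *\<^sub>R \<gamma> t) (at t)"
    using geodesic_equation[OF \<open>geodesic \<gamma>\<close>] by blast
  have v: "\<gamma>' 0 \<in> tangent_sub ?S (\<gamma> 0)" using v vector_derivative_at[OF d1[of 0]] by simp
  define c where "c = inverse (vec_part (\<gamma> 0) \<bullet> (P *v vec_part (\<gamma> 0)))"
  have "c > 0"
    using z posdef_pos[OF P] by (simp add: Union_plane_trace[OF P] c_def)
  define L where "L z = covec_part z + c *\<^sub>R (P *v vec_part z)" for z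
  have bl: "bounded_linear L"
    unfolding L_def
    by (intro bounded_linear_add bounded_linear_covec_part
        bounded_linear_compose[OF bounded_linear_scaleR_right]
        bounded_linear_compose[OF matrix_vector_mul_bounded_linear bounded_linear_vec_part])
  have "L (\<gamma> t) = 0"
  proof (rule linear_ode_zero)
    show "((\<lambda>t. L (\<gamma> t)) has_vector_derivative L (\<gamma>' t)) (at t)" for t
      by (rule bounded_linear.has_vector_derivative[OF bl d1])
    show "((\<lambda>t. L (\<gamma>' t)) has_vector_derivative pairing (\<gamma>' 0) (\<gamma>' 0) *\<^sub>R L (\<gamma> t)) (at t)" for t
      using bounded_linear.has_vector_derivative[OF bl d2]
      by (simp add: linear_cmul[OF bounded_linear.linear[OF bl]])
    show "L (\<gamma> 0) = 0"
      using z by (simp add: Union_plane_trace[OF P] trace_covec_def L_def c_def)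
    show "L (\<gamma>' 0) = 0"
      using trace_tangent[OF P z v] by (simp add: L_def c_def)
    show "pairing (\<gamma>' 0) (\<gamma>' 0) \<le> 0"
    proof (cases "\<gamma>' 0 = 0")
      case False
      then have "metric_g (\<gamma>' 0) (\<gamma>' 0) < 0"
        using trace_neg_definite[OF P] z v by (auto simp: neg_definite_def)
      then show ?thesis by (simp add: metric_g_pairing)
    qed (simp add: pairing_simps)
  qed
  then have "\<gamma> t \<in> graph_plane (c *\<^sub>R P)"
    by (simp add: graph_plane_def L_def eq_neg_iff_add_eq_0 flip: scaleR_matrix_vector_assoc)
  moreover have "\<gamma> t \<in> quadric" using \<open>geodesic \<gamma>\<close> by (auto simp: geodesic_def)
  ultimately have "\<gamma> t \<in> \<Union>(plane_trace (graph_plane (c *\<^sub>R P)))"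
    using orbit_self by (auto simp: plane_trace_def)
  then show "\<gamma> t \<in> \<Union>?S" unfolding plane_trace_scaleR[OF P \<open>c > 0\<close>] .
qed

text \<open>
  The projection to the quotient: the preimage of a set of orbits is its union.
\<close>

lemma continuous_map_orbit: "continuous_map (top_of_set quadric) hyp_topology orbit"
proof -
  have "openin (top_of_set quadric) {z \<in> topspace (top_of_set quadric). orbit z \<in> W}"
    if "openin hyp_topology W" for W :: "'a pvec set set"
  proof -
    have W: "W \<subseteq> hyp" "openin (top_of_set quadric) (\<Union>W)"
      using that by (simp_all add: openin_hyp_topology)
    have "{z \<in> topspace (top_of_set quadric). orbit z \<in> W} = \<Union>W"
      using Union_hyp[OF W(1)] orbit_in_iff[OF W(1)] by auto
    with W(2) show ?thesis by simp
  qed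
  moreover have "orbit z \<in> topspace hyp_topology" if "z \<in> quadric" for z :: "'a pvec"
  proof -
    have "\<Union>(hyp :: 'a pvec set set) = quadric"
      using Union_hyp[OF order_refl] orbit_self by (auto simp: hyp_def)
    then have "openin hyp_topology (hyp :: 'a pvec set set)" by (simp add: openin_hyp_topology)
    then show ?thesis using that openin_subset by (auto simp: hyp_def)
  qed
  ultimately show ?thesis by (auto simp: continuous_map_def)
qed

text \<open>
  Parametrise the trace by the vectors \<open>x\<close> with \<open>x \<bullet> P e \<ge> 0\<close>, where \<open>e\<close> is some fixed nonzero vector. This
  is enough as \<open>x\<close> and \<open>-x\<close> yield the same orbit. Unlike the set of all nonzero vectors, these form a set
  that is starlike, hence connected, also in dimension one.
\<close>

lemma trace_connected:
  fixes P :: "'n::{finite,linorder} rmat"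
  assumes P: "posdef P"
  shows "plane_trace (graph_plane P) \<noteq> {}" "connectedin hyp_topology (plane_trace (graph_plane P))"
proof -
  let ?S = "plane_trace (graph_plane P)"
  define e :: "(real, 'n) vec" where "e = 1"
  have "e \<noteq> 0" by (simp add: e_def)
  define G where "G x = of_parts x (trace_covec P x)" for x
  define C where "C = {x. x \<noteq> 0 \<and> 0 \<le> x \<bullet> (P *v e)}"
  have G: "G x \<in> \<Union>?S" if "x \<noteq> 0" for x
    using that by (simp add: Union_plane_trace[OF P] G_def)
  have "G e \<in> \<Union>?S" using G \<open>e \<noteq> 0\<close> by simp
  then show "?S \<noteq> {}" by blast
  have "starlike C"
    unfolding starlike_def
  proof (intro bexI ballI subsetI)
    show "e \<in> C" using \<open>e \<noteq> 0\<close> posdef_pos[OF P \<open>e \<noteq> 0\<close>] by (simp add: C_def)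
    fix x y assume x: "x \<in> C" and "y \<in> closed_segment e x"
    then obtain t where t: "0 \<le> t" "t \<le> 1" and y: "y = (1 - t) *\<^sub>R e + t *\<^sub>R x"
      by (auto simp: closed_segment_def)
    have yP: "y \<bullet> (P *v e) = (1 - t) * (e \<bullet> (P *v e)) + t * (x \<bullet> (P *v e))"
      by (simp add: y inner_add_left)
    show "y \<in> C"
    proof (cases "t = 1")
      case True
      then show ?thesis using x y by simp
    next
      case False
      then have "(1 - t) * (e \<bullet> (P *v e)) > 0" using t posdef_pos[OF P \<open>e \<noteq> 0\<close>] by simp
      moreover have "t * (x \<bullet> (P *v e)) \<ge> 0" using t x by (simp add: C_def)
      ultimately have "y \<bullet> (P *v e) > 0" by (simp add: yP)
      then show ?thesis by (auto simp: C_def)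
    qed
  qed
  have "continuous_on C G"
    unfolding G_def
    by (intro continuous_on_of_parts continuous_on_id
        continuous_on_subset[OF continuous_on_trace_covec[OF P]]) (auto simp: C_def)
  then have "connected (G ` C)"
    using starlike_imp_connected[OF \<open>starlike C\<close>] connected_continuous_image by blast
  moreover have "G ` C \<subseteq> quadric"
    using G Union_hyp[OF plane_trace_subset_hyp] by (auto simp: C_def)
  ultimately have "connectedin hyp_topology (orbit ` G ` C)"
    by (intro connectedin_continuous_map_image[OF continuous_map_orbit])
      (simp add: connectedin_subtopology)
  moreover have "orbit ` G ` C = ?S"
  proof (intro set_eqI iffI)
    fix p assume "p \<in> orbit ` G ` C"
    then show "p \<in> ?S"
      using G orbit_in_iff[OF plane_trace_subset_hyp] by (auto simp: C_def)
  next
    fix p assume "p \<in> ?S"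
    then obtain z where p: "p = orbit z" and z: "z \<in> \<Union>?S"
      using eq_orbit_image[OF plane_trace_subset_hyp[of "graph_plane P"]] by blast
    define x where "x = vec_part z"
    have "x \<noteq> 0" and "z = G x"
      using z by (auto simp: Union_plane_trace[OF P] x_def G_def intro: parts_eqI)
    have "G (- x) = - G x"
      by (rule parts_eqI) (simp_all add: G_def part_simps trace_covec_def linear_neg[OF matrix_vector_mul_linear])
    then have "G (- x) \<in> orbit z"
      unfolding \<open>z = G x\<close> in_orbit_iff by (intro exI[of _ "-1"]) (simp add: part_simps)
    then have "orbit (G (- x)) = p" unfolding p by (rule orbit_eq)
    moreover have "orbit (G x) = p" by (simp add: p \<open>z = G x\<close>)
    moreover have "x \<in> C \<or> - x \<in> C" using \<open>x \<noteq> 0\<close> by (auto simp: C_def)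
    ultimately show "p \<in> orbit ` G ` C" by blast
  qed
  ultimately show "connectedin hyp_topology ?S" by simp
qed

lemma trace_in_space_N:
  "posdef P \<Longrightarrow> plane_trace (graph_plane P) \<in> space_N"
  by (simp add: space_N_def trace_connected trace_lagrangian trace_totally_geodesic
      trace_neg_definite)

section \<open>Totally geodesic Lagrangian subspaces are traces of planes\<close>

text \<open>
  Testing with the orthogonal complement reduces this to derivatives of constant functions.
\<close>

lemma vector_derivative_in_subspace:
  fixes f :: "real \<Rightarrow> 'a::euclidean_space"
  assumes "(f has_vector_derivative d) (at t)" "open T" "t \<in> T" "\<And>s. s \<in> T \<Longrightarrow> f s \<in> E" "subspace E"
  shows "d \<in> E"
proof -
  have "w \<bullet> d = 0" if "w \<in> E\<^sup>\<bottom>" for w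
  proof -
    have "((\<lambda>s. w \<bullet> f s) has_vector_derivative w \<bullet> d) (at t)"
      by (rule bounded_linear.has_vector_derivative[OF bounded_linear_inner_right assms(1)])
    moreover have "w \<bullet> f s = 0" if "s \<in> T" for s
      using \<open>w \<in> E\<^sup>\<bottom>\<close> assms(4)[OF that]
      by (auto simp: orthogonal_comp_def orthogonal_def inner_commute)
    ultimately have "((\<lambda>s. 0) has_vector_derivative w \<bullet> d) (at t)"
      by (rule has_vector_derivative_transform_within_open[OF _ assms(2,3)])
    then show ?thesis by (rule derivative_of_constant) simp
  qed
  then have "d \<in> (E\<^sup>\<bottom>)\<^sup>\<bottom>"
    by (auto simp: orthogonal_comp_def orthogonal_def inner_commute)
  then show ?thesis by (simp add: orthogonal_comp_self assms(5))
qed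

text \<open>
  In a slice chart the curves in \<open>M\<close> are those in the subspace \<open>E\<close>, so the derivative of the inverse chart
  maps \<open>E\<close> isomorphically onto the space of velocities.
\<close>

lemma submanifold_velocities:
  fixes M :: "'a::euclidean_space set"
  assumes "submanifold k M" "z \<in> M"
  shows "subspace (velocities M z)" "dim (velocities M z) = k"
proof -
  obtain U V \<phi> \<psi> and E :: "'a set" where "z \<in> U" and \<phi>: "smooth_on_open U \<phi>" and \<psi>: "smooth_on_open V \<psi>"
    and hom: "homeomorphism U V \<phi> \<psi>" and E: "subspace E" "dim E = k" and slice: "\<phi> ` (M \<inter> U) = E \<inter> V"
    using assms unfolding submanifold_def by meson
  have U: "open U" and V: "open V" using \<phi> \<psi> by (simp_all add: smooth_on_open_def)
  have inv: "\<psi> (\<phi> y) = y" if "y \<in> U" for y using hom that by (simp add: homeomorphism_def)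
  have inv': "\<phi> (\<psi> y) = y" if "y \<in> V" for y using hom that by (simp add: homeomorphism_def)
  have "\<phi> z \<in> V" using hom \<open>z \<in> U\<close> by (auto simp: homeomorphism_def)
  define d\<phi> where "d\<phi> = frechet_derivative \<phi> (at z)"
  define d\<psi> where "d\<psi> = frechet_derivative \<psi> (at (\<phi> z))"
  have d\<phi>: "(\<phi> has_derivative d\<phi>) (at z)"
    unfolding d\<phi>_def by (rule smooth_on_open_imp_has_derivative[OF \<phi> \<open>z \<in> U\<close>])
  have d\<psi>: "(\<psi> has_derivative d\<psi>) (at (\<phi> z))"
    unfolding d\<psi>_def by (rule smooth_on_open_imp_has_derivative[OF \<psi> \<open>\<phi> z \<in> V\<close>])
  have "((\<psi> \<circ> \<phi>) has_derivative d\<psi> \<circ> d\<phi>) (at z)"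
    using diff_chain_at[OF d\<phi> d\<psi>] .
  then have "((\<lambda>y. y) has_derivative d\<psi> \<circ> d\<phi>) (at z)"
    by (rule has_derivative_transform_within_open[OF _ U \<open>z \<in> U\<close>]) (simp add: inv)
  then have "d\<psi> \<circ> d\<phi> = (\<lambda>y. y)" using has_derivative_unique has_derivative_ident by blast
  then have left: "d\<psi> (d\<phi> v) = v" for v by (metis comp_apply)
  have "((\<phi> \<circ> \<psi>) has_derivative d\<phi> \<circ> d\<psi>) (at (\<phi> z))"
    using diff_chain_at[OF d\<psi>, of \<phi> d\<phi>] d\<phi> by (simp add: inv \<open>z \<in> U\<close>)
  then have "((\<lambda>y. y) has_derivative d\<phi> \<circ> d\<psi>) (at (\<phi> z))"
    by (rule has_derivative_transform_within_open[OF _ V \<open>\<phi> z \<in> V\<close>]) (simp add: inv')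
  then have "d\<phi> \<circ> d\<psi> = (\<lambda>y. y)" using has_derivative_unique has_derivative_ident by blast
  then have right: "d\<phi> (d\<psi> v) = v" for v by (metis comp_apply)
  have linear: "linear d\<psi>" using has_derivative_linear[OF d\<psi>] .
  have \<phi>z: "\<phi> z \<in> E" using slice \<open>z \<in> U\<close> \<open>z \<in> M\<close> by blast
  have "velocities M z = d\<psi> ` E"
  proof (intro set_eqI iffI)
    fix v assume "v \<in> velocities M z"
    then obtain \<gamma> where \<gamma>: "\<And>t::real. \<gamma> t \<in> M" "\<gamma> 0 = z" "(\<gamma> has_vector_derivative v) (at 0)"
      unfolding velocities_def by blast
    have "isCont \<gamma> 0" using \<gamma>(3) by (rule has_vector_derivative_continuous)
    then obtain T where T: "open T" "0 \<in> T" "\<And>t. t \<in> T \<Longrightarrow> \<gamma> t \<in> U"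
      using U \<open>z \<in> U\<close> \<gamma>(2) unfolding continuous_at_open by metis
    have "((\<phi> \<circ> \<gamma>) has_vector_derivative d\<phi> v) (at 0)"
      using d\<phi> \<gamma>(2) vector_derivative_diff_chain_within[OF \<gamma>(3), of \<phi> d\<phi>]
      by (simp add: has_derivative_at_withinI)
    moreover have "(\<phi> \<circ> \<gamma>) t \<in> E" if "t \<in> T" for t
      using slice T(3)[OF that] \<gamma>(1)[of t] by auto
    ultimately have "d\<phi> v \<in> E" using vector_derivative_in_subspace T(1,2) E(1) by blast
    then show "v \<in> d\<psi> ` E" using left by (metis imageI)
  next
    fix v assume "v \<in> d\<psi> ` E"
    then obtain e where "e \<in> E" and v: "v = d\<psi> e" by blast
    \<comment> \<open>Staying at \<open>z\<close> when the line has left the chart does not affect the velocity at \<open>0\<close>.\<close>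
    define \<gamma> where "\<gamma> t = (if \<phi> z + t *\<^sub>R e \<in> V then \<psi> (\<phi> z + t *\<^sub>R e) else z)" for t :: real
    have "\<gamma> t \<in> M" for t
    proof (cases "\<phi> z + t *\<^sub>R e \<in> V")
      case True
      then have "\<phi> z + t *\<^sub>R e \<in> \<phi> ` (M \<inter> U)"
        unfolding slice using \<phi>z \<open>e \<in> E\<close> E(1) by (simp add: subspace_add subspace_scale)
      then obtain y where "y \<in> M" "y \<in> U" "\<phi> z + t *\<^sub>R e = \<phi> y" by blast
      then show ?thesis using True inv by (simp add: \<gamma>_def)
    qed (simp add: \<gamma>_def \<open>z \<in> M\<close>)
    moreover have "\<gamma> 0 = z" by (simp add: \<gamma>_def inv \<open>z \<in> U\<close>)
    moreover have "(\<gamma> has_vector_derivative v) (at 0)"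
    proof -
      have line: "((\<lambda>t. \<phi> z + t *\<^sub>R e) has_vector_derivative e) (at 0)"
        by (auto intro!: derivative_eq_intros)
      have "((\<psi> \<circ> (\<lambda>t. \<phi> z + t *\<^sub>R e)) has_vector_derivative v) (at 0)"
        unfolding v using d\<psi> vector_derivative_diff_chain_within[OF line, of \<psi> d\<psi>]
        by (simp add: has_derivative_at_withinI)
      moreover have "open ((\<lambda>t. \<phi> z + t *\<^sub>R e) -` V)"
        by (intro open_vimage V continuous_intros)
      moreover have "0 \<in> (\<lambda>t. \<phi> z + t *\<^sub>R e) -` V" using \<open>\<phi> z \<in> V\<close> by simp
      ultimately show ?thesis
        by (rule has_vector_derivative_transform_within_open) (simp add: \<gamma>_def)
    qed
    ultimately show "v \<in> velocities M z" unfolding velocities_def by blast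
  qed
  moreover have "dim (d\<psi> ` E) = dim E"
    by (rule dim_image_eq[OF linear]) (metis inj_on_def right)
  ultimately show "subspace (velocities M z)" "dim (velocities M z) = k"
    using linear_subspace_image[OF linear E(1)] E(2) by simp_all
qed

text \<open>
  In the negative definite plane spanned by \<open>z\<close> and \<open>\<xi>\<close> the geodesic is an ellipse, just like a great
  circle of a sphere.
\<close>

lemma geodesic_circle:
  assumes "z \<in> quadric" "\<xi> \<in> tangent z" "pairing \<xi> \<xi> = - (\<kappa>\<^sup>2)" "\<kappa> > 0"
  defines "\<gamma> \<equiv> \<lambda>t. cos (\<kappa> * t) *\<^sub>R z + (sin (\<kappa> * t) / \<kappa>) *\<^sub>R \<xi>"
  shows "geodesic \<gamma>" "vector_derivative \<gamma> (at 0) = \<xi>"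
proof -
  define \<gamma>' where "\<gamma>' t = (- \<kappa> * sin (\<kappa> * t)) *\<^sub>R z + cos (\<kappa> * t) *\<^sub>R \<xi>" for t
  have d1: "(\<gamma> has_vector_derivative \<gamma>' t) (at t)" for t
    unfolding \<gamma>_def \<gamma>'_def using \<open>\<kappa> > 0\<close>
    by (auto intro!: derivative_eq_intros has_vector_derivative_add has_vector_derivative_scaleR
        simp: has_real_derivative_iff_has_vector_derivative[symmetric])
  have d2: "(\<gamma>' has_vector_derivative (- (\<kappa>\<^sup>2)) *\<^sub>R \<gamma> t) (at t)" for t
  proof -
    have "(\<gamma>' has_vector_derivative (- \<kappa> * (\<kappa> * cos (\<kappa> * t))) *\<^sub>R z + (- \<kappa> * sin (\<kappa> * t)) *\<^sub>R \<xi>) (at t)"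
      unfolding \<gamma>'_def
      by (auto intro!: derivative_eq_intros
        simp: has_real_derivative_iff_has_vector_derivative[symmetric]) (simp add: algebra_simps)
    also have "(- \<kappa> * (\<kappa> * cos (\<kappa> * t))) *\<^sub>R z + (- \<kappa> * sin (\<kappa> * t)) *\<^sub>R \<xi> = (- (\<kappa>\<^sup>2)) *\<^sub>R \<gamma> t"
      using \<open>\<kappa> > 0\<close> by (simp add: \<gamma>_def algebra_simps power2_eq_square)
    finally show ?thesis .
  qed
  have pair: "pairing z z = -1" "pairing \<xi> z = 0" "pairing z \<xi> = 0"
    using assms(1,2) by (simp_all add: in_quadric_iff in_tangent_iff)
  have quadric: "\<gamma> t \<in> quadric" for t
  proof -
    have "pairing (\<gamma> t) (\<gamma> t) = - ((cos (\<kappa> * t))\<^sup>2 + (sin (\<kappa> * t))\<^sup>2)"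
      using \<open>\<kappa> > 0\<close> by (simp add: \<gamma>_def pairing_simps pair assms(3) power2_eq_square field_simps)
    then show ?thesis by (simp add: in_quadric_iff)
  qed
  have tangent: "\<gamma>' t \<in> tangent (\<gamma> t)" for t
    using \<open>\<kappa> > 0\<close>
    by (simp add: in_tangent_iff \<gamma>'_def \<gamma>_def pairing_simps pair assms(3) power2_eq_square)
  have eq: "(- (\<kappa>\<^sup>2)) *\<^sub>R \<gamma> t + qform ((- (\<kappa>\<^sup>2)) *\<^sub>R \<gamma> t) (\<gamma> t) *s \<gamma> t = 0" for t
  proof -
    have "pairing (\<gamma> t) (\<gamma> t) = -1" using quadric[of t] by (simp add: in_quadric_iff)
    then have "qform ((- (\<kappa>\<^sup>2)) *\<^sub>R \<gamma> t) (\<gamma> t) = Paracomplex (\<kappa>\<^sup>2) 0"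
      by (simp add: qform_pairing pairing_simps)
    then show ?thesis by (simp add: vec_eq_iff paracomplex_eq_iff)
  qed
  show "geodesic \<gamma>"
    unfolding geodesic_def
    by (intro exI[of _ \<gamma>'] exI[of _ "\<lambda>t. (- (\<kappa>\<^sup>2)) *\<^sub>R \<gamma> t"] allI conjI quadric d1 d2 tangent eq)
  show "vector_derivative \<gamma> (at 0) = \<xi>"
    using vector_derivative_at[OF d1[of 0]] by (simp add: \<gamma>'_def)
qed

text \<open>
  Let \<open>W\<close> be the tangent space of the preimage of \<open>S\<close> at \<open>z\<close>. It is the sum of its horizontal part \<open>T\<close>
  and the direction \<open>\<tau> z\<close> of the orbit. Replacing \<open>\<tau> z\<close> by \<open>z\<close> gives a plane of the same
  dimension. Being orthogonal to \<open>z\<close>, the space \<open>T\<close> passes on its isotropy and its negativity to the plane.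
  A point of the plane with \<open>q = -1\<close> is \<open>a z + \<xi>\<close> with \<open>a\<^sup>2 + \<kappa>\<^sup>2 = 1\<close> for \<open>\<kappa>\<^sup>2 = - q(\<xi>, \<xi>)\<close>, hence lies on
  the geodesic in the direction of \<open>\<xi>\<close>.
\<close>

lemma ex_tangent_plane:
  fixes S :: "'n::{finite,linorder} pvec set set"
  assumes S: "S \<in> space_N" and z: "z \<in> \<Union>S"
  obtains V where "V \<in> lagrangian_neg_planes" "z \<in> V" "V \<inter> quadric \<subseteq> \<Union>S"
proof -
  have hyp: "S \<subseteq> hyp" and sub: "submanifold CARD('n) (\<Union>S)"
    using S unfolding space_N_def lagrangian_def hyp_submanifold_def by simp_all
  have "lagrangian S" "neg_definite S" "totally_geodesic S"
    using S by (simp_all add: space_N_def)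
  then have omega: "omega v w = 0" if "v \<in> tangent_sub S z" "w \<in> tangent_sub S z" for v w
    using that z unfolding lagrangian_def by blast
  have neg: "metric_g v v < 0" if "v \<in> tangent_sub S z" "v \<noteq> 0" for v
    using \<open>neg_definite S\<close> that z unfolding neg_definite_def by blast
  have geo: "\<gamma> t \<in> \<Union>S" if "geodesic \<gamma>" "\<gamma> 0 \<in> \<Union>S"
    "vector_derivative \<gamma> (at 0) \<in> tangent_sub S (\<gamma> 0)" for \<gamma> t
    using \<open>totally_geodesic S\<close> that unfolding totally_geodesic_def by blast
  define W where "W = velocities (\<Union>S) z"
  define T where "T = tangent_sub S z"
  have W: "subspace W" "dim W = CARD('n)"
    using submanifold_velocities[OF sub z] by (simp_all add: W_def)
  have T_W: "T \<subseteq> W" by (auto simp: T_def W_def tangent_sub_def)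
  have quadric: "w \<in> quadric" if "w \<in> \<Union>S" for w using Union_hyp[OF hyp] that by blast
  have zz: "pairing z z = -1" using quadric[OF z] by (simp add: in_quadric_iff)
  have "T = W \<inter> tangent z" by (simp add: T_def W_def tangent_sub_def)
  moreover have "subspace (tangent z)"
    by (auto simp: subspace_def in_tangent_iff pairing_simps)
  ultimately have T: "subspace T" using W(1) by (simp add: subspace_inter)
  then have span_T: "span T = T" by (simp add: span_eq_iff)
  \<comment> \<open>This is \<open>\<tau> z\<close>.\<close>
  define n where "n = of_parts (vec_part z) (- covec_part z)"
  have nz: "pairing n z = -1" "pairing z n = 1"
    using zz by (simp_all add: n_def pairing_def)
  have "n \<in> W"
    unfolding W_def velocities_def
  proof (intro CollectI exI conjI allI)
    let ?\<gamma> = "\<lambda>t::real. of_parts (exp t *\<^sub>R vec_part z) (exp (- t) *\<^sub>R covec_part z)"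
    show "?\<gamma> t \<in> \<Union>S" for t
    proof -
      have "?\<gamma> t \<in> orbit z" unfolding in_orbit_iff by (intro exI[of _ "exp t"]) (simp add: exp_minus)
      then show ?thesis by (rule orbit_subset_Union[OF hyp z])
    qed
    show "?\<gamma> 0 = z" by simp
    have "((\<lambda>t. (exp t *\<^sub>R vec_part z, exp (- t) *\<^sub>R covec_part z)) has_vector_derivative
        (vec_part z, - covec_part z)) (at 0)"
      by (auto intro!: has_vector_derivative_Pair derivative_eq_intros
          simp: has_real_derivative_iff_has_vector_derivative[symmetric])
    from bounded_linear.has_vector_derivative[OF bounded_linear_of_parts this]
    show "(?\<gamma> has_vector_derivative n) (at 0)" by (simp add: n_def)
  qed
  have W_sym: "pairing w z + pairing z w = 0" if w: "w \<in> W" for w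
  proof -
    obtain \<gamma> where \<gamma>: "\<And>t::real. \<gamma> t \<in> \<Union>S" "\<gamma> 0 = z" "(\<gamma> has_vector_derivative w) (at 0)"
      using w unfolding W_def velocities_def by blast
    have "pairing (\<gamma> t) (\<gamma> t) = -1" for t using quadric[OF \<gamma>(1)[of t]] by (simp add: in_quadric_iff)
    then show ?thesis
      using derivative_of_constant[OF bounded_bilinear.has_vector_derivative[OF bounded_bilinear_pairing
          \<gamma>(3) \<gamma>(3)], of "-1"] by (simp add: \<gamma>(2))
  qed
  have "W \<subseteq> span (insert n T)"
  proof
    fix w assume "w \<in> W"
    have "w + pairing w z *\<^sub>R n \<in> W" using \<open>w \<in> W\<close> \<open>n \<in> W\<close> W(1) by (simp add: subspace_add subspace_scale)
    moreover have "w + pairing w z *\<^sub>R n \<in> tangent z"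
      using W_sym[OF \<open>w \<in> W\<close>] by (simp add: in_tangent_iff pairing_simps nz)
    ultimately have "w - (- pairing w z) *\<^sub>R n \<in> span T"
      unfolding span_T by (simp add: \<open>T = W \<inter> tangent z\<close>)
    then show "w \<in> span (insert n T)" unfolding span_breakdown_eq by blast
  qed
  then have "CARD('n) \<le> dim (insert n T)" using dim_subset[of W "span (insert n T)"] W(2) by simp
  have tan: "pairing \<xi> z = 0" "pairing z \<xi> = 0" if "\<xi> \<in> T" for \<xi>
    using that by (simp_all add: T_def tangent_sub_def in_tangent_iff)
  have "n \<notin> span T" unfolding span_T using nz tan(1)[of n] by auto
  then have "dim (insert n T) = dim T + 1" by (simp add: dim_insert)
  moreover have "dim (insert n T) \<le> CARD('n)"
    using dim_subset[of "insert n T" W] \<open>n \<in> W\<close> T_W W(2) by simp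
  moreover have "z \<notin> span T" unfolding span_T using zz tan(1)[of z] by auto
  then have "dim (insert z T) = dim T + 1" by (simp add: dim_insert)
  ultimately have dim: "dim (insert z T) = CARD('n)" using \<open>CARD('n) \<le> dim (insert n T)\<close> by simp
  define V where "V = span (insert z T)"
  have V_cases: "\<exists>a \<xi>. v = a *\<^sub>R z + \<xi> \<and> \<xi> \<in> T" if v: "v \<in> V" for v
  proof -
    obtain a where "v - a *\<^sub>R z \<in> T"
      using v unfolding V_def span_breakdown_eq span_T by blast
    then show ?thesis by (intro exI[of _ a] exI[of _ "v - a *\<^sub>R z"]) simp
  qed
  have pair: "pairing (a *\<^sub>R z + \<xi>) (b *\<^sub>R z + \<eta>) = pairing \<xi> \<eta> - a * b" if "\<xi> \<in> T" "\<eta> \<in> T" for a b \<xi> \<eta>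
    using that by (simp add: pairing_simps tan zz)
  have negT: "pairing \<xi> \<xi> < 0" if "\<xi> \<in> T" "\<xi> \<noteq> 0" for \<xi>
    using neg[of \<xi>] that by (simp add: T_def metric_g_pairing)
  have "V \<in> lagrangian_neg_planes"
    unfolding lagrangian_neg_planes_def
  proof (intro CollectI conjI ballI impI)
    show "subspace V" by (simp add: V_def)
    show "dim V = CARD('n)" by (simp add: V_def dim)
  next
    fix v w assume "v \<in> V" "w \<in> V"
    then obtain a \<xi> b \<eta> where v: "v = a *\<^sub>R z + \<xi>" "\<xi> \<in> T" and w: "w = b *\<^sub>R z + \<eta>" "\<eta> \<in> T"
      using V_cases by metis
    have "pairing \<xi> \<eta> = pairing \<eta> \<xi>" using omega[of \<xi> \<eta>] v(2) w(2) by (simp add: T_def omega_pairing)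
    then show "pIm (qform v w) = 0"
      unfolding pIm_qform v(1) w(1) pair[OF v(2) w(2)] pair[OF w(2) v(2)] by simp
  next
    fix v assume "v \<in> V" "v \<noteq> 0"
    then obtain a \<xi> where v: "v = a *\<^sub>R z + \<xi>" "\<xi> \<in> T" using V_cases by metis
    have "pairing \<xi> \<xi> - a * a < 0"
    proof (cases "\<xi> = 0")
      case True
      then have "a \<noteq> 0" using v(1) \<open>v \<noteq> 0\<close> by auto
      then have "a * a > 0" by (metis not_real_square_gt_zero)
      then show ?thesis using True by (simp add: pairing_simps)
    next
      case False
      then have "pairing \<xi> \<xi> < 0" using negT v(2) by simp
      moreover have "a * a \<ge> 0" by simp
      ultimately show ?thesis by linarith
    qed
    then show "pRe (qform v v) < 0"
      unfolding pRe_qform v(1) pair[OF v(2) v(2)] by simp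
  qed
  moreover have "z \<in> V" by (simp add: V_def span_base)
  moreover have "V \<inter> quadric \<subseteq> \<Union>S"
  proof
    fix v assume "v \<in> V \<inter> quadric"
    then obtain a \<xi> where v: "v = a *\<^sub>R z + \<xi>" "\<xi> \<in> T" and "pairing v v = -1"
      using V_cases by (metis IntE in_quadric_iff)
    then have a: "pairing \<xi> \<xi> - a * a = -1" using pair[OF v(2) v(2)] by simp
    show "v \<in> \<Union>S"
    proof (cases "\<xi> = 0")
      case True
      then have "a * a = 1" using a by (simp add: pairing_simps)
      then have "a \<noteq> 0" "inverse a = a" using inverse_unique[of a a] by auto
      then have "v \<in> orbit z"
        unfolding in_orbit_iff v(1) True by (intro exI[of _ a]) (simp add: part_simps)
      then show ?thesis by (rule orbit_subset_Union[OF hyp z])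
    next
      case False
      define \<kappa> where "\<kappa> = sqrt (- pairing \<xi> \<xi>)"
      have \<kappa>: "\<kappa> > 0" "pairing \<xi> \<xi> = - (\<kappa>\<^sup>2)"
        using negT[OF v(2) False] by (simp_all add: \<kappa>_def)
      have "a\<^sup>2 + \<kappa>\<^sup>2 = 1" using a \<kappa>(2) by (simp add: power2_eq_square)
      then obtain \<theta> where \<theta>: "a = cos \<theta>" "\<kappa> = sin \<theta>" by (metis sincos_total_2pi)
      define \<gamma> where "\<gamma> = (\<lambda>t. cos (\<kappa> * t) *\<^sub>R z + (sin (\<kappa> * t) / \<kappa>) *\<^sub>R \<xi>)"
      have \<xi>: "\<xi> \<in> tangent z" using v(2) by (simp add: T_def tangent_sub_def)
      note circle = geodesic_circle[OF quadric[OF z] \<xi> \<kappa>(2,1), folded \<gamma>_def]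
      have "\<gamma> 0 = z" by (simp add: \<gamma>_def)
      have "\<gamma> (\<theta> / \<kappa>) \<in> \<Union>S"
        by (rule geo[OF circle(1)]) (use z v(2) circle(2) in \<open>simp_all del: Union_iff add: \<open>\<gamma> 0 = z\<close> T_def\<close>)
      moreover have "\<gamma> (\<theta> / \<kappa>) = v"
      proof -
        have "\<kappa> * (\<theta> / \<kappa>) = \<theta>" using \<kappa>(1) by simp
        moreover have "sin \<theta> / \<kappa> = 1" using \<theta>(2) \<kappa>(1) by simp
        ultimately show ?thesis by (simp add: \<gamma>_def v(1) \<theta>(1))
      qed
      ultimately show ?thesis by simp
    qed
  qed
  ultimately show ?thesis by (rule that)
qed

lemma ex_frame:
  assumes "V \<in> lagrangian_neg_planes"
  obtains Z :: "'n::{finite,linorder} pmat" where "Z \<in> frames" "span (rows Z) = V"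
proof -
  have V: "subspace V" "dim V = CARD('n)" using assms lagrangian_neg_planesD by auto
  obtain B where B: "B \<subseteq> V" "independent B" "V \<subseteq> span B" "card B = CARD('n)"
    using basis_exists[of V] V(2) by metis
  have "finite B" using B(2) by (rule independent_imp_finite)
  then obtain b :: "'n \<Rightarrow> 'n pvec" where b: "bij_betw b UNIV B"
    using finite_same_card_bij[OF finite_class.finite_UNIV, of B] B(4) by auto
  define Z where "Z = (\<chi> i. b i)"
  have "rows Z = B" using b by (auto simp: rows_def row_def Z_def bij_betw_def)
  then have "span (rows Z) = V" using B(1,3) V(1) by (metis span_subspace)
  with assms that[of Z] show ?thesis by (simp add: frames_def)
qed

text \<open>
  Parametrised by the nonzero vectors and read in a slice chart of \<open>M\<close>, the trace is a continuous injection
  between spaces of equal dimension, to which invariance of domain applies.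
\<close>

lemma trace_open_in_submanifold:
  fixes P :: "'n::{finite,linorder} rmat" and M :: "'n pvec set"
  assumes P: "posdef P" and M: "submanifold CARD('n) M"
    and sub: "\<Union>(plane_trace (graph_plane P)) \<subseteq> M"
  shows "openin (top_of_set M) (\<Union>(plane_trace (graph_plane P)))"
proof (subst openin_subopen, intro ballI)
  let ?N = "\<Union>(plane_trace (graph_plane P))"
  fix w assume w: "w \<in> ?N"
  define G where "G x = of_parts x (trace_covec P x)" for x
  have N: "?N = G ` (- {0})"
  proof (intro set_eqI iffI)
    fix z assume "z \<in> ?N"
    then have "vec_part z \<in> - {0}" "z = G (vec_part z)"
      by (auto simp: Union_plane_trace[OF P] G_def intro: parts_eqI)
    then show "z \<in> G ` (- {0})" by blast
  qed (auto simp: Union_plane_trace[OF P] G_def simp del: Union_iff)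
  obtain U V \<phi> \<psi> and E :: "'n pvec set" where "w \<in> U" and \<phi>: "smooth_on_open U \<phi>"
    and hom: "homeomorphism U V \<phi> \<psi>" and E: "subspace E" "dim E = CARD('n)" and slice: "\<phi> ` (M \<inter> U) = E \<inter> V"
    using M w sub unfolding submanifold_def by (meson subsetD)
  have U: "open U" using \<phi> by (simp add: smooth_on_open_def)
  have cont: "continuous_on (- {0}) G"
    unfolding G_def by (intro continuous_on_of_parts continuous_on_id continuous_on_trace_covec P)
  define D where "D = (- {0}) \<inter> G -` U"
  have "open D" unfolding D_def by (rule continuous_open_preimage[OF cont _ U]) auto
  have inj\<phi>: "inj_on \<phi> U" using hom by (metis homeomorphism_def inj_on_inverseI)
  have "openin (top_of_set E) ((\<lambda>x. \<phi> (G x)) ` D)"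
  proof (rule invariance_of_domain_subspaces)
    show "openin (top_of_set UNIV) D" using \<open>open D\<close> by simp
    show "continuous_on D (\<lambda>x. \<phi> (G x))"
      by (rule continuous_on_compose2[OF smooth_on_open_imp_continuous_on[OF \<phi>]
            continuous_on_subset[OF cont]]) (auto simp: D_def)
    show "(\<lambda>x. \<phi> (G x)) \<in> D \<rightarrow> E"
    proof
      fix x assume "x \<in> D"
      then have "G x \<in> M \<inter> U" using N sub by (auto simp: D_def simp del: Union_iff)
      then show "\<phi> (G x) \<in> E" using slice by blast
    qed
    show "inj_on (\<lambda>x. \<phi> (G x)) D"
    proof (rule inj_onI)
      fix x y assume "x \<in> D" "y \<in> D" "\<phi> (G x) = \<phi> (G y)"
      then have "G x = G y" using inj\<phi> by (auto simp: D_def dest: inj_onD)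
      then show "x = y" unfolding G_def by (metis vec_part_of_parts)
    qed
  qed (simp_all add: E)
  then obtain O' where "open O'" and O': "(\<lambda>x. \<phi> (G x)) ` D = E \<inter> O'" by (auto simp: openin_open)
  define Ow where "Ow = U \<inter> \<phi> -` O'"
  have "open Ow" unfolding Ow_def
    by (rule continuous_open_preimage[OF smooth_on_open_imp_continuous_on[OF \<phi>] U \<open>open O'\<close>])
  have "w \<in> Ow"
  proof -
    obtain x where "x \<noteq> 0" "w = G x" using w unfolding N by auto
    then have "\<phi> w \<in> (\<lambda>x. \<phi> (G x)) ` D" using \<open>w \<in> U\<close> by (auto simp: D_def)
    then show ?thesis using \<open>w \<in> U\<close> by (simp add: O' Ow_def)
  qed
  moreover have "M \<inter> Ow \<subseteq> ?N"
  proof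
    fix y assume y: "y \<in> M \<inter> Ow"
    then have "\<phi> y \<in> E \<inter> O'" using slice by (auto simp: Ow_def)
    then obtain x where "x \<in> D" "\<phi> y = \<phi> (G x)" unfolding O'[symmetric] by blast
    then have "y = G x" using inj\<phi> y by (auto simp: D_def Ow_def dest: inj_onD)
    then show "y \<in> ?N" using \<open>x \<in> D\<close> by (simp add: N D_def)
  qed
  ultimately show "\<exists>T. openin (top_of_set M) T \<and> w \<in> T \<and> T \<subseteq> ?N"
    using w sub \<open>open Ow\<close> by (intro exI[of _ "M \<inter> Ow"]) (auto simp: openin_open_Int simp del: Union_iff)
qed

text \<open>
  On the quadric \<open>x \<noteq> 0\<close> is automatic, and the equation of the graph is closed once the denominator is
  cleared.
\<close>

lemma trace_closed_in_quadric:
  fixes P :: "'n::{finite,linorder} rmat"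
  assumes P: "posdef P"
  shows "closedin (top_of_set quadric) (\<Union>(plane_trace (graph_plane P)))"
proof -
  let ?f = "\<lambda>z. (vec_part z \<bullet> (P *v vec_part z)) *\<^sub>R covec_part z + P *v vec_part z"
  have "\<Union>(plane_trace (graph_plane P)) = quadric \<inter> {z. ?f z = 0}"
  proof (intro set_eqI iffI)
    fix z assume z: "z \<in> \<Union>(plane_trace (graph_plane P))"
    then have "z \<in> quadric" using Union_hyp[OF plane_trace_subset_hyp] by blast
    with z show "z \<in> quadric \<inter> {z. ?f z = 0}"
      using posdef_pos[OF P, of "vec_part z"] by (simp add: Union_plane_trace[OF P] trace_covec_def)
  next
    fix z assume z: "z \<in> quadric \<inter> {z. ?f z = 0}"
    then have x: "vec_part z \<noteq> 0" by (auto simp: in_quadric_iff pairing_def)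
    let ?q = "vec_part z \<bullet> (P *v vec_part z)"
    have "?q > 0" by (rule posdef_pos[OF P x])
    have "?q *\<^sub>R covec_part z = - (P *v vec_part z)" using z by (simp add: eq_neg_iff_add_eq_0)
    then have "inverse ?q *\<^sub>R (?q *\<^sub>R covec_part z) = trace_covec P (vec_part z)"
      by (simp add: trace_covec_def)
    then have "covec_part z = trace_covec P (vec_part z)" using \<open>?q > 0\<close> by simp
    with x show "z \<in> \<Union>(plane_trace (graph_plane P))" by (simp add: Union_plane_trace[OF P])
  qed
  moreover have "closed {z. ?f z = 0}"
    by (intro closed_Collect_eq continuous_intros linear_continuous_on bounded_linear_vec_part
        bounded_linear_covec_part bounded_linear_compose[OF matrix_vector_mul_bounded_linear])
  ultimately show ?thesis by (auto simp: closedin_closed)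
qed

text \<open>
  The trace is open and closed in the connected set \<open>S\<close>. The topology of the quotient requires saturated
  sets: an open set cutting the trace out of \<open>S\<close> upstairs is replaced by the union of its dilates.
\<close>

lemma space_N_eq_trace:
  fixes P :: "'n::{finite,linorder} rmat"
  assumes S: "S \<in> space_N" and P: "posdef P" and sub: "plane_trace (graph_plane P) \<subseteq> S"
  shows "S = plane_trace (graph_plane P)"
proof -
  let ?N = "\<Union>(plane_trace (graph_plane P))"
  have hyp: "S \<subseteq> hyp" and submanifold: "submanifold CARD('n) (\<Union>S)"
    and connected: "connectedin hyp_topology S"
    using S unfolding space_N_def lagrangian_def hyp_submanifold_def by simp_all
  note saturated = orbit_in_iff[OF plane_trace_subset_hyp[of "graph_plane P"]]
  have N_quadric: "?N \<subseteq> quadric" by (rule Union_hyp[OF plane_trace_subset_hyp])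
  obtain B where "open B" and B: "?N = \<Union>S \<inter> B"
    using trace_open_in_submanifold[OF P submanifold Union_mono[OF sub]] by (auto simp: openin_open)
  define E1 where "E1 = orbit ` (quadric \<inter> B)"
  define E2 where "E2 = orbit ` (quadric - ?N)"
  have "openin hyp_topology E1"
    unfolding openin_hyp_topology
  proof
    show "E1 \<subseteq> hyp" by (auto simp: E1_def hyp_def)
    have "\<Union>E1 = quadric \<inter> (\<Union>a\<in>-{0}. dilate a -` B)"
    proof (intro set_eqI iffI)
      fix y assume "y \<in> \<Union>E1"
      then obtain w where w: "w \<in> quadric" "w \<in> B" "y \<in> orbit w" by (auto simp: E1_def)
      moreover obtain a where "a \<noteq> 0" "w = dilate a y"
        using orbit_sym[OF w(3)] by (auto simp: in_orbit_dilate)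
      ultimately show "y \<in> quadric \<inter> (\<Union>a\<in>-{0}. dilate a -` B)"
        using orbit_subset_quadric[OF w(1,3)] by auto
    next
      fix y assume "y \<in> quadric \<inter> (\<Union>a\<in>-{0}. dilate a -` B)"
      then obtain a where "y \<in> quadric" "a \<noteq> 0" "dilate a y \<in> B" by auto
      moreover from this have "dilate a y \<in> orbit y" by (auto simp: in_orbit_dilate)
      ultimately show "y \<in> \<Union>E1"
        using orbit_subset_quadric[of y "dilate a y"] orbit_sym[of "dilate a y" y]
        by (auto simp: E1_def)
    qed
    moreover have "open (dilate a -` B)" for a
    proof -
      have "continuous_on UNIV (dilate a)"
        unfolding dilate_def
        by (intro continuous_on_of_parts continuous_on_scaleR continuous_on_const
            linear_continuous_on bounded_linear_vec_part bounded_linear_covec_part)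
      then show ?thesis using \<open>open B\<close> by (intro open_vimage)
    qed
    ultimately show "openin (top_of_set quadric) (\<Union>E1)"
      by (simp add: openin_open_Int open_UN)
  qed
  moreover have "openin hyp_topology E2"
    unfolding openin_hyp_topology
  proof
    show "E2 \<subseteq> hyp" by (auto simp: E2_def hyp_def)
    have "\<Union>E2 = quadric - ?N"
    proof (intro set_eqI iffI)
      fix y assume "y \<in> \<Union>E2"
      then obtain w where w: "w \<in> quadric" "w \<notin> ?N" "y \<in> orbit w" unfolding E2_def by blast
      then have "y \<notin> ?N" using orbit_eq[OF w(3)] saturated by metis
      then show "y \<in> quadric - ?N" using orbit_subset_quadric[OF w(1,3)] by blast
    next
      fix y assume "y \<in> quadric - ?N"
      then show "y \<in> \<Union>E2" unfolding E2_def using orbit_self by blast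
    qed
    moreover have "openin (top_of_set quadric) (quadric - ?N)"
      using trace_closed_in_quadric[OF P] by (simp add: closedin_def)
    ultimately show "openin (top_of_set quadric) (\<Union>E2)" by simp
  qed
  moreover have "S \<subseteq> E1 \<union> E2"
  proof
    fix p assume "p \<in> S"
    then obtain y where y: "p = orbit y" "y \<in> quadric" by (rule hyp_cases[OF hyp])
    then have "y \<in> \<Union>S" using \<open>p \<in> S\<close> by (simp only: orbit_in_iff[OF hyp])
    show "p \<in> E1 \<union> E2"
    proof (cases "y \<in> ?N")
      case True
      then have "y \<in> B" unfolding B by blast
      then show ?thesis using y by (simp add: E1_def)
    next
      case False
      then show ?thesis using y unfolding E2_def by blast
    qed
  qed
  moreover have "E1 \<inter> E2 \<inter> S = {}"
  proof (rule ccontr)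
    assume "E1 \<inter> E2 \<inter> S \<noteq> {}"
    then obtain w v where w: "orbit w \<in> S" "w \<in> B" and v: "orbit w = orbit v" "v \<notin> ?N"
      unfolding E1_def E2_def by blast
    have "w \<in> ?N" unfolding B using w orbit_in_iff[OF hyp] by blast
    then show False using v saturated by metis
  qed
  moreover have "E1 \<inter> S \<noteq> {}"
  proof -
    obtain z where "z \<in> ?N" using trace_connected(1)[OF P] saturated
      eq_orbit_image[OF plane_trace_subset_hyp[of "graph_plane P"]] by blast
    then have "orbit z \<in> S" "z \<in> B" "z \<in> quadric"
      using B saturated sub N_quadric by blast+
    then show ?thesis by (auto simp: E1_def)
  qed
  ultimately have "E2 \<inter> S = {}" using connected unfolding connectedin by metis
  have "\<Union>S \<subseteq> ?N"
  proof
    fix y assume "y \<in> \<Union>S"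
    then have "orbit y \<in> S" "y \<in> quadric" using orbit_in_iff[OF hyp] Union_hyp[OF hyp] by blast+
    then show "y \<in> ?N" using \<open>E2 \<inter> S = {}\<close> unfolding E2_def by blast
  qed
  with Union_mono[OF sub] have "\<Union>S = ?N" by simp
  then show ?thesis
    using eq_orbit_image[OF hyp] eq_orbit_image[OF plane_trace_subset_hyp[of "graph_plane P"]] by metis
qed

lemma space_N_eq_frame_traces:
  assumes odd: "odd CARD('n)"
  shows "(\<lambda>Z :: 'n::{finite,linorder} pmat. plane_trace (span (rows Z))) ` frames = space_N"
proof (intro set_eqI iffI)
  fix S assume "S \<in> (\<lambda>Z :: 'n pmat. plane_trace (span (rows Z))) ` frames"
  then obtain Z :: "'n pmat" where Z: "Z \<in> frames" and S: "S = plane_trace (span (rows Z))" by blast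
  obtain A :: "'n rmat" where "det A = 1" "plane_trace (span (rows Z)) = plane_trace (graph_plane (inverse_gram A))"
    using smooth_local_section[OF odd Z] Z by blast
  then show "S \<in> space_N" unfolding S by (simp add: trace_in_space_N posdef_inverse_gram)
next
  fix S :: "'n pvec set set" assume S: "S \<in> space_N"
  then have hyp: "S \<subseteq> hyp" and "S \<noteq> {}"
    unfolding space_N_def lagrangian_def hyp_submanifold_def by simp_all
  then obtain z where z: "z \<in> \<Union>S" using eq_orbit_image[OF hyp] by blast
  obtain V where V: "V \<in> lagrangian_neg_planes" "z \<in> V" "V \<inter> quadric \<subseteq> \<Union>S"
    by (rule ex_tangent_plane[OF S z])
  obtain Z :: "'n pmat" where Z: "Z \<in> frames" "span (rows Z) = V" by (rule ex_frame[OF V(1)])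
  obtain A :: "'n rmat" where A: "det A = 1" "plane_trace (span (rows Z)) = plane_trace (graph_plane (inverse_gram A))"
    using smooth_local_section[OF odd Z(1)] Z(1) by blast
  have "plane_trace V \<subseteq> S"
    using V(3) orbit_in_iff[OF hyp] unfolding plane_trace_def by blast
  then have "S = plane_trace V"
    using space_N_eq_trace[OF S posdef_inverse_gram[of A]] A Z(2) by simp
  then show "S \<in> (\<lambda>Z :: 'n pmat. plane_trace (span (rows Z))) ` frames" using Z by blast
qed

section \<open>Cosets of the special orthogonal group\<close>

lemma inverse_gram_mult:
  fixes A :: "'n::finite rmat"
  assumes "det A \<noteq> 0" "det B \<noteq> 0"
  shows "inverse_gram (A ** B) = transpose (matrix_inv A) ** inverse_gram B ** matrix_inv A"
proof -
  have "(A ** B) ** (matrix_inv B ** matrix_inv A) = A ** (B ** matrix_inv B) ** matrix_inv A"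
    by (simp only: matrix_mul_assoc)
  then have "matrix_inv (A ** B) = matrix_inv B ** matrix_inv A"
    by (intro matrix_inv_unique) (simp add: matrix_inv_inverse assms)
  then show ?thesis
    by (simp only: inverse_gram_def matrix_transpose_mul matrix_mul_assoc)
qed

lemma inverse_gram_SO:
  assumes "det A \<noteq> 0" "R \<in> SO"
  shows "inverse_gram (A ** R) = inverse_gram A"
proof -
  have R: "R ** transpose R = mat 1" using assms(2) by (simp add: SO_def orthogonal_matrix_def)
  then have "matrix_inv R = transpose R" by (rule matrix_inv_unique)
  then have "inverse_gram R = mat 1" using R by (simp add: inverse_gram_def)
  moreover have "det R \<noteq> 0" using assms(2) by (simp add: SO_def)
  ultimately show ?thesis
    using inverse_gram_mult[OF assms(1), of R] by (simp add: inverse_gram_def[of A])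
qed

lemma SO_coset_self: "A \<in> SO_coset A"
proof -
  have "mat 1 \<in> SO" by (simp add: SO_def orthogonal_matrix_id)
  then have "A ** mat 1 \<in> SO_coset A" unfolding SO_coset_def by (rule imageI)
  then show ?thesis by simp
qed

lemma SO_coset_mult:
  assumes "R \<in> SO"
  shows "SO_coset (A ** R) = SO_coset A"
proof (intro set_eqI iffI)
  fix C assume "C \<in> SO_coset (A ** R)"
  then obtain S where S: "S \<in> SO" "C = A ** (R ** S)"
    unfolding SO_coset_def by (auto simp: matrix_mul_assoc)
  have "R ** S \<in> SO" using assms S(1) by (simp add: SO_def orthogonal_matrix_mul det_mul)
  then show "C \<in> SO_coset A" unfolding SO_coset_def S(2) by (rule imageI)
next
  fix C assume "C \<in> SO_coset A"
  then obtain S where S: "S \<in> SO" "C = A ** S" unfolding SO_coset_def by auto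
  have "R ** transpose R = mat 1" using assms by (simp add: SO_def orthogonal_matrix_def)
  then have "A ** S = A ** (R ** transpose R) ** S" by simp
  then have "C = (A ** R) ** (transpose R ** S)" unfolding S(2) by (simp only: matrix_mul_assoc)
  moreover have "transpose R ** S \<in> SO"
    using assms S(1) by (simp add: SO_def orthogonal_matrix_mul orthogonal_matrix_transpose det_mul)
  ultimately show "C \<in> SO_coset (A ** R)" unfolding SO_coset_def by blast
qed

text \<open>
  The basis vectors being eigenvectors makes \<open>K\<close> diagonal, and the sums of two basis vectors being
  eigenvectors makes the diagonal entries equal.
\<close>

lemma scalar_matrixI:
  fixes K :: "'n::finite rmat"
  assumes "\<And>x. \<exists>k. K *v x = k *\<^sub>R x"
  shows "\<exists>k. K = k *\<^sub>R mat 1"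
proof -
  have entry: "(K *v axis j 1) $ i = K $ i $ j" for i j
    by (simp add: matrix_vector_mult_basis column_def)
  have off: "K $ i $ j = 0" if "i \<noteq> j" for i j
  proof -
    obtain k where k: "K *v axis j 1 = k *\<^sub>R axis j 1" using assms by blast
    have "K $ i $ j = (k *\<^sub>R axis j (1::real)) $ i" by (simp only: k[symmetric] entry)
    then show ?thesis using that by (simp add: axis_def)
  qed
  have diag: "K $ i $ i = K $ j $ j" for i j
  proof (cases "i = j")
    case False
    obtain k where k: "K *v (axis i 1 + axis j 1) = k *\<^sub>R (axis i 1 + axis j 1)" using assms by blast
    have sum: "(K *v (axis i 1 + axis j 1)) $ l = K $ l $ i + K $ l $ j" for l
      by (simp add: matrix_vector_right_distrib entry)
    have "K $ i $ i = k" "K $ j $ j = k"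
      using sum[of i] sum[of j] False off[of i j] off[of j i] unfolding k by (simp_all add: axis_def)
    then show ?thesis by simp
  qed simp
  define k where "k = K $ undefined $ undefined"
  have "K $ i $ j = (k *\<^sub>R mat 1) $ i $ j" for i j
    using off[of i j] diag[of i undefined] by (cases "i = j") (simp_all add: mat_def k_def)
  then have "K = k *\<^sub>R mat 1" by (simp add: vec_eq_iff)
  then show ?thesis by blast
qed

text \<open>
  Equal traces are graphs of equal functions \<open>x \<mapsto> - P x / (x \<bullet> P x)\<close>. So \<open>P x\<close> and \<open>P' x\<close> are positively
  proportional for every \<open>x\<close>, every vector is an eigenvector of \<open>P\<^sup>-\<^sup>1 P'\<close>, and this matrix is a positive
  multiple of the identity. Its determinant is \<open>1\<close>.
\<close>

lemma inverse_gram_eq_of_trace_eq: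
  fixes A B :: "'n::{finite,linorder} rmat"
  assumes A: "det A = 1" and B: "det B = 1"
    and eq: "plane_trace (graph_plane (inverse_gram A)) = plane_trace (graph_plane (inverse_gram B))"
  shows "inverse_gram A = inverse_gram B"
proof -
  define P P' where "P = inverse_gram A" and "P' = inverse_gram B"
  have pos: "posdef P" "posdef P'" using A B by (simp_all add: P_def P'_def posdef_inverse_gram)
  define G where "G = A ** transpose A"
  have GP: "G ** P = mat 1"
  proof -
    have "G ** P = A ** (transpose A ** transpose (matrix_inv A)) ** matrix_inv A"
      by (simp only: G_def P_def inverse_gram_def matrix_mul_assoc)
    also have "transpose A ** transpose (matrix_inv A) = mat 1"
      using A by (simp add: matrix_inv_inverse flip: matrix_transpose_mul)
    finally show ?thesis using A by (simp add: matrix_inv_inverse)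
  qed
  define ratio where "ratio x = (x \<bullet> (P' *v x)) / (x \<bullet> (P *v x))" for x
  have ratio: "(G ** P') *v x = ratio x *\<^sub>R x" "ratio x > 0" if "x \<noteq> 0" for x
  proof -
    let ?q = "x \<bullet> (P *v x)" and ?q' = "x \<bullet> (P' *v x)"
    have q: "?q > 0" "?q' > 0" using posdef_pos pos that by blast+
    have "of_parts x (trace_covec P x) \<in> \<Union>(plane_trace (graph_plane P'))"
      unfolding P'_def eq[symmetric] P_def[symmetric]
      using that by (simp add: Union_plane_trace[OF pos(1)])
    then have "trace_covec P x = trace_covec P' x" by (simp add: Union_plane_trace[OF pos(2)])
    then have "inverse ?q *\<^sub>R (P *v x) = inverse ?q' *\<^sub>R (P' *v x)" by (simp add: trace_covec_def)
    then have "?q' *\<^sub>R (inverse ?q *\<^sub>R (P *v x)) = ?q' *\<^sub>R (inverse ?q' *\<^sub>R (P' *v x))" by simp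
    then have "P' *v x = ratio x *\<^sub>R (P *v x)" using q by (simp add: ratio_def divide_inverse)
    then have "(G ** P') *v x = ratio x *\<^sub>R ((G ** P) *v x)"
      by (simp add: matrix_vector_mult_scaleR flip: matrix_vector_mul_assoc)
    then show "(G ** P') *v x = ratio x *\<^sub>R x" by (simp add: GP)
    show "ratio x > 0" using q by (simp add: ratio_def)
  qed
  have "\<exists>k. (G ** P') *v x = k *\<^sub>R x" for x
    using ratio(1)[of x] by (cases "x = 0") auto
  then obtain k where k: "G ** P' = k *\<^sub>R mat 1" using scalar_matrixI by blast
  have det_inv: "det (matrix_inv B) = 1"
    using det_mul[of B "matrix_inv B"] B by (simp add: matrix_inv_inverse)
  have "k ^ CARD('n) = det (G ** P')" unfolding k det_scaleR by simp
  also have "\<dots> = 1" by (simp add: G_def P'_def inverse_gram_def det_mul A det_inv)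
  finally have "k ^ CARD('n) = 1 ^ CARD('n)" by simp
  moreover have "k > 0"
  proof -
    have "(1 :: (real, 'n) vec) \<noteq> 0" by simp
    from ratio[OF this] show ?thesis unfolding k by (simp flip: scaleR_matrix_vector_assoc)
  qed
  ultimately have "k = 1" using power_eq_imp_eq_base[of k "CARD('n)" 1] by simp
  then have "G ** P' = mat 1" using k by simp
  then have "matrix_inv G = P'" by (rule matrix_inv_unique)
  moreover have "matrix_inv G = P" using GP by (rule matrix_inv_unique)
  ultimately show ?thesis by (simp add: P_def P'_def)
qed

text \<open>
  \<open>B\<^sup>-\<^sup>1 A\<close> carries the standard inner product first to the form \<open>A\<^sup>-\<^sup>t A\<^sup>-\<^sup>1 = B\<^sup>-\<^sup>t B\<^sup>-\<^sup>1\<close> and then back, so it is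
  orthogonal.
\<close>

lemma SO_coset_eq_of_inverse_gram_eq:
  fixes A B :: "'n::finite rmat"
  assumes A: "det A = 1" and B: "det B = 1" and eq: "inverse_gram A = inverse_gram B"
  shows "SO_coset A = SO_coset B"
proof -
  define R where "R = matrix_inv B ** A"
  have BR: "B ** R = A" using B by (simp add: R_def matrix_mul_assoc matrix_inv_inverse)
  have "transpose R ** R = transpose A ** inverse_gram B ** A"
    by (simp only: R_def inverse_gram_def matrix_transpose_mul matrix_mul_assoc)
  also have "\<dots> = (transpose A ** transpose (matrix_inv A)) ** (matrix_inv A ** A)"
    unfolding eq[symmetric] by (simp only: inverse_gram_def matrix_mul_assoc)
  also have "\<dots> = mat 1"
    using A by (simp add: matrix_inv_inverse flip: matrix_transpose_mul)
  finally have "orthogonal_matrix R" by (simp add: orthogonal_matrix)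
  moreover have "det R = 1" using det_mul[of B R] A B by (simp add: BR)
  ultimately have "R \<in> SO" by (simp add: SO_def)
  from SO_coset_mult[OF this, of B] show ?thesis by (simp add: BR)
qed

section \<open>The action of the special linear group\<close>

lemma vec_part_act [simp]: "vec_part (act_matrix A *v z) = A *v vec_part z"
proof (rule vec_eq_iff[THEN iffD2, rule_format])
  fix i
  have mult: "pRe (u * v) + pIm (u * v) = (pRe u + pIm u) * (pRe v + pIm v)" for u v
    by (simp add: algebra_simps)
  have entry: "pRe (act_matrix A $ i $ j) + pIm (act_matrix A $ i $ j) = A $ i $ j" for j
    by (simp add: act_matrix_def e_plus_def e_minus_def of_real_def)
  show "vec_part (act_matrix A *v z) $ i = (A *v vec_part z) $ i"
    by (simp add: vec_part_def matrix_vector_mult_def pRe_sum pIm_sum del: paracomplex_simps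
        flip: sum.distrib) (simp only: mult entry)
qed

lemma covec_part_act [simp]:
  "covec_part (act_matrix A *v z) = transpose (matrix_inv A) *v covec_part z"
proof -
  let ?D = "antidiag ** transpose (matrix_inv A) ** antidiag"
  let ?y = "\<chi> i. pRe (z $ i) - pIm (z $ i)"
  have mult: "pRe (u * v) - pIm (u * v) = (pRe u - pIm u) * (pRe v - pIm v)" for u v
    by (simp add: algebra_simps)
  have entry: "pRe (act_matrix A $ i $ j) - pIm (act_matrix A $ i $ j) = ?D $ i $ j" for i j
    by (simp add: act_matrix_def e_plus_def e_minus_def of_real_def)
  have "(\<chi> i. pRe ((act_matrix A *v z) $ i) - pIm ((act_matrix A *v z) $ i)) = ?D *v ?y"
  proof (rule vec_eq_iff[THEN iffD2, rule_format])
    fix i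
    have "pRe ((act_matrix A *v z) $ i) - pIm ((act_matrix A *v z) $ i)
        = (\<Sum>j\<in>UNIV. pRe (act_matrix A $ i $ j * z $ j) - pIm (act_matrix A $ i $ j * z $ j))"
      by (simp only: matrix_vector_mult_def vec_lambda_beta pRe_sum pIm_sum sum_subtractf)
    also have "\<dots> = (?D *v ?y) $ i"
      by (simp only: mult entry) (simp add: matrix_vector_mult_def)
    finally show "(\<chi> i. pRe ((act_matrix A *v z) $ i) - pIm ((act_matrix A *v z) $ i)) $ i
        = (?D *v ?y) $ i" by simp
  qed
  then have "covec_part (act_matrix A *v z) = antidiag *v (?D *v ?y)" unfolding covec_part_def by simp
  also have "\<dots> = (antidiag ** antidiag) *v (transpose (matrix_inv A) *v (antidiag *v ?y))"
    by (simp only: matrix_vector_mul_assoc matrix_mul_assoc)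
  also have "\<dots> = transpose (matrix_inv A) *v covec_part z"
    by (simp del: transpose_matrix_vector add: antidiag_involution covec_part_def)
  finally show ?thesis .
qed

lemma act_dilate: "act_matrix A *v dilate a z = dilate a (act_matrix A *v z)"
  by (rule parts_eqI) (simp_all add: dilate_def matrix_vector_mult_scaleR del: transpose_matrix_vector)

lemma act_hyp_orbit: "act_hyp A (orbit z) = orbit (act_matrix A *v z)"
proof -
  have orbit: "orbit w = (\<lambda>a. dilate a w) ` (- {0})" for w :: "'a pvec"
    by (auto simp: in_orbit_dilate)
  show ?thesis by (simp add: act_hyp_def orbit image_image act_dilate)
qed

lemma act_pairing:
  assumes "det A \<noteq> 0"
  shows "pairing (act_matrix A *v z) (act_matrix A *v w) = pairing z w"
  by (simp add: pairing_def inner_transpose matrix_inv_vec[OF assms] del: transpose_matrix_vector)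

lemma act_N_trace:
  fixes A B :: "'n::{finite,linorder} rmat"
  assumes A: "det A \<noteq> 0" and B: "det B \<noteq> 0"
  shows "act_N A (plane_trace (graph_plane (inverse_gram B)))
    = plane_trace (graph_plane (inverse_gram (A ** B)))"
proof -
  let ?V = "graph_plane (inverse_gram B)" and ?V' = "graph_plane (inverse_gram (A ** B))"
  have gram: "inverse_gram (A ** B) *v x = transpose (matrix_inv A) *v (inverse_gram B *v (matrix_inv A *v x))" for x
    by (simp only: inverse_gram_mult[OF A B] matrix_vector_mul_assoc matrix_mul_assoc)
  have "(\<lambda>z. act_matrix A *v z) ` (?V \<inter> quadric) = ?V' \<inter> quadric"
  proof (intro set_eqI iffI)
    fix w assume "w \<in> (\<lambda>z. act_matrix A *v z) ` (?V \<inter> quadric)"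
    then obtain z where w: "w = act_matrix A *v z" and z: "z \<in> ?V" "z \<in> quadric" by blast
    have "w \<in> quadric" using z(2) by (simp add: w in_quadric_iff act_pairing[OF A])
    moreover have "w \<in> ?V'"
      using z(1) by (simp del: transpose_matrix_vector add: graph_plane_def w gram matrix_inv_vec[OF A]
          linear_neg[OF matrix_vector_mul_linear])
    ultimately show "w \<in> ?V' \<inter> quadric" by simp
  next
    fix w assume w: "w \<in> ?V' \<inter> quadric"
    define z where "z = of_parts (matrix_inv A *v vec_part w) (transpose A *v covec_part w)"
    have zw: "act_matrix A *v z = w"
      by (rule parts_eqI) (simp_all del: transpose_matrix_vector add: z_def A matrix_inv_vec[OF A] transpose_vec_inv[OF A])
    have "pairing z z = pairing w w" using act_pairing[OF A, of z z] by (simp add: zw)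
    then have "z \<in> quadric" using w by (simp add: in_quadric_iff)
    moreover have "z \<in> ?V"
      using w by (simp del: transpose_matrix_vector add: graph_plane_def z_def gram transpose_vec_inv[OF A]
          linear_neg[OF matrix_vector_mul_linear])
    ultimately show "w \<in> (\<lambda>z. act_matrix A *v z) ` (?V \<inter> quadric)" using zw by blast
  qed
  then show ?thesis
    by (simp add: act_N_def plane_trace_def image_image act_hyp_orbit flip: image_image[of orbit "\<lambda>z. act_matrix A *v z"])
qed

section \<open>The equivariant diffeomorphism\<close>

text \<open>
  The choice of a representative is immaterial since \<open>inverse_gram\<close> is constant on cosets.
\<close>

definition coset_trace :: "'n::{finite,linorder} rmat set \<Rightarrow> 'n pvec set set"
  where "coset_trace c = plane_trace (graph_plane (inverse_gram (SOME A. A \<in> c)))"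

lemma coset_trace_SO_coset:
  assumes "det A = 1"
  shows "coset_trace (SO_coset A) = plane_trace (graph_plane (inverse_gram A))"
proof -
  have "(SOME B. B \<in> SO_coset A) \<in> SO_coset A" using SO_coset_self by (rule someI)
  then obtain R where "R \<in> SO" "(SOME B. B \<in> SO_coset A) = A ** R" unfolding SO_coset_def by blast
  then show ?thesis using inverse_gram_SO[of A R] assms by (simp add: coset_trace_def)
qed

theorem theorem4p9:
  fixes m :: nat
  assumes "CARD('n::{finite,linorder}) = 2 * m + 1"
  shows "\<exists>F :: 'n rmat set \<Rightarrow> 'n pvec set set.
    quotient_diffeomorphism SL SO_coset space_X
      frames (\<lambda>Z. plane_trace (span (rows Z))) space_N F \<and>
    (\<forall>A\<in>SL. \<forall>c\<in>space_X. F (act_X A c) = act_N A (F c))"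
proof (intro exI[of _ coset_trace] conjI ballI)
  have odd: "odd CARD('n)" using assms by simp
  let ?trace = "\<lambda>Z :: 'n pmat. plane_trace (span (rows Z))"
  have frame: "?trace (frame_of A) = coset_trace (SO_coset A)" if "A \<in> SL" for A
    using that by (simp add: SL_def span_frame_of coset_trace_SO_coset)
  have frame_in: "frame_of A \<in> frames" if "A \<in> SL" for A :: "'n rmat"
    using that by (simp add: SL_def frame_of_in_frames)
  have inj: "inj_on coset_trace (space_X :: 'n rmat set set)"
  proof (rule inj_onI)
    fix c d :: "'n rmat set" assume "c \<in> space_X" "d \<in> space_X" and eq: "coset_trace c = coset_trace d"
    then obtain A B where A: "c = SO_coset A" "det A = 1" and B: "d = SO_coset B" "det B = 1"
      by (auto simp: space_X_def SL_def)
    have "inverse_gram A = inverse_gram B"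
      by (rule inverse_gram_eq_of_trace_eq[OF A(2) B(2)])
        (use eq A B in \<open>simp add: coset_trace_SO_coset\<close>)
    then show "c = d" unfolding A(1) B(1) by (rule SO_coset_eq_of_inverse_gram_eq[OF A(2) B(2)])
  qed
  have image: "coset_trace ` space_X = (space_N :: 'n pvec set set set)"
  proof (intro set_eqI iffI)
    fix S :: "'n pvec set set" assume "S \<in> coset_trace ` space_X"
    then obtain A :: "'n rmat" where "det A = 1" "S = coset_trace (SO_coset A)"
      by (auto simp: space_X_def SL_def)
    then show "S \<in> space_N"
      by (simp add: coset_trace_SO_coset trace_in_space_N posdef_inverse_gram)
  next
    fix S :: "'n pvec set set" assume "S \<in> space_N"
    then obtain Z where Z: "Z \<in> frames" "S = ?trace Z"
      unfolding space_N_eq_frame_traces[OF odd, symmetric] by blast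
    then obtain A :: "'n rmat" where "det A = 1" "S = plane_trace (graph_plane (inverse_gram A))"
      using smooth_local_section[OF odd Z(1)] by blast
    then show "S \<in> coset_trace ` space_X"
      by (auto simp: space_X_def SL_def coset_trace_SO_coset intro!: image_eqI[of _ _ "SO_coset A"])
  qed
  have "quotient_smooth SL SO_coset frames ?trace coset_trace"
    unfolding quotient_smooth_def
    by (intro ballI exI[of _ UNIV] exI[of _ frame_of])
      (use smooth_frame_of[of UNIV] frame frame_in in auto)
  moreover have "quotient_smooth frames ?trace SL SO_coset (inv_into space_X coset_trace)"
    unfolding quotient_smooth_def
  proof
    fix Z0 :: "'n pmat" assume "Z0 \<in> frames"
    from smooth_local_section[OF odd this]
    obtain U and h :: "'n pmat \<Rightarrow> 'n rmat" where U: "open U" "Z0 \<in> U" and h: "smooth_on_open U h"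
      and lift: "\<forall>Z \<in> U \<inter> frames. det (h Z) = 1 \<and> ?trace Z = plane_trace (graph_plane (inverse_gram (h Z)))"
      by blast
    have "h Z \<in> SL \<and> SO_coset (h Z) = inv_into space_X coset_trace (?trace Z)" if "Z \<in> frames \<inter> U" for Z
    proof -
      have Z: "det (h Z) = 1" "?trace Z = plane_trace (graph_plane (inverse_gram (h Z)))"
        using lift that by auto
      then have "?trace Z = coset_trace (SO_coset (h Z))" by (simp add: coset_trace_SO_coset)
      moreover have "SO_coset (h Z) \<in> space_X" using Z(1) by (simp add: space_X_def SL_def)
      ultimately show ?thesis using Z(1) inv_into_f_f[OF inj] by (simp add: SL_def)
    qed
    moreover have "smooth_on_subset (frames \<inter> U) h" using smooth_on_open_imp_subset[OF h] by simp
    ultimately show "\<exists>U h. open U \<and> Z0 \<in> U \<and> smooth_on_subset (frames \<inter> U) h \<and>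
       (\<forall>Z\<in>frames \<inter> U. h Z \<in> SL \<and> SO_coset (h Z) = inv_into space_X coset_trace (?trace Z))"
      using U by blast
  qed
  ultimately show "quotient_diffeomorphism SL SO_coset space_X frames ?trace space_N coset_trace"
    unfolding quotient_diffeomorphism_def bij_betw_def
    using inj image space_N_eq_frame_traces[OF odd] by (simp add: space_X_def)
  fix A :: "'n rmat" and c :: "'n rmat set" assume A: "A \<in> SL" and "c \<in> space_X"
  then obtain B where c: "c = SO_coset B" and B: "det B = 1" by (auto simp: space_X_def SL_def)
  have "act_X A c = SO_coset (A ** B)"
    unfolding act_X_def c SO_coset_def by (simp add: image_image matrix_mul_assoc)
  then show "coset_trace (act_X A c) = act_N A (coset_trace c)"
    using A B by (simp add: c coset_trace_SO_coset SL_def det_mul act_N_trace)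
qed

end
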